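(* Let $p$ be a prime, $q=p^e$ with $e\ge1$, and $m\ge e$ an integer. Let $L_m(q)$ be the linearized Wenger graph: the bipartite graph whose vertex set is the disjoint union of a point set $\mathbb{F}_q^{m+1}$ and a line set $\mathbb{F}_q^{m+1}$, with a point $P=(p_1,\dots,p_{m+1})$ adjacent to a line $L=[l_1,\dots,l_{m+1}]$ if and only if $l_k+p_k=p_1^{\,p^{k-2}}\,l_1$ for all $k=2,\dots,m+1$. Then $L_m(q)$ has $q^{m-e}$ connected components, and the distinct eigenvalues of its adjacency matrix are $0$ and $\pm\sqrt{qp^i}$ for $0\le i\le e$. For $0\le i\le e$ the multiplicity of each of $\pm\sqrt{qp^i}$ is $q^{m-e}n_{p^i}$, where $$n_{p^i}=p^{e-i}\,\frac{\prod_{j=0}^{e-i-1}(p^e-p^j)^2}{\prod_{j=0}^{e-i-1}(p^{e-i}-p^j)},$$ and the multiplicity of the eigenvalue $0$ is $q^{m-e}n_0$, where $$n_0=\sum_{i=1}^{e}(p^e-p^{e-i})\,\frac{\prod_{j=0}^{e-i-1}(p^e-p^j)^2}{\prod_{j=0}^{e-i-1}(p^{e-i}-p^j)}.$$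
   Context: Empty products equal $1$. Eigenvalues are those of the adjacency matrix of the graph (with $2q^{m+1}$ vertices).
   Formalization: The multiplicity of the eigenvalue 0 is corrected to 2q^{m-e}n_0: the stated value q^{m-e}n_0 is always too small by a factor 2 (for p=2, e=m=1 the graph is the 8-cycle, n_0=1, but 0 has multiplicity 2). *)

theory Defs
  imports "Jordan_Normal_Form.Spectral_Radius"
begin

section \<open>Linearized Wenger graphs\<close>

text \<open>
  Coordinate vectors \<open>(x\<^sub>1, \<dots>, x\<^bsub>m+1\<^esub>)\<close> are represented by functions on the index set
  \<open>{1..m+1}\<close> with values in the whole type, extended by \<open>undefined\<close> outside of that set.
  Both \<open>P 1\<close> and \<open>L 1\<close> are therefore the first coordinates, as on paper.
\<close>

definition coord_vectors :: "nat \<Rightarrow> (nat \<Rightarrow> 'a) set" where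
  "coord_vectors m = {1..m+1} \<rightarrow>\<^sub>E UNIV"

text \<open>\<open>Inl\<close> tags points, \<open>Inr\<close> tags lines.\<close>

definition wenger_verts :: "nat \<Rightarrow> ((nat \<Rightarrow> 'a) + (nat \<Rightarrow> 'a)) set" where
  "wenger_verts m = coord_vectors m <+> coord_vectors m"

definition wenger_incident :: "nat \<Rightarrow> nat \<Rightarrow> (nat \<Rightarrow> 'a::field) \<Rightarrow> (nat \<Rightarrow> 'a) \<Rightarrow> bool" where
  "wenger_incident p m P L \<longleftrightarrow>
     (\<forall>k\<in>{2..m+1}. L k + P k = P 1 ^ (p ^ (k - 2)) * L 1)"

text \<open>The symmetric adjacency relation of the undirected graph.\<close>

definition wenger_adj ::
  "nat \<Rightarrow> nat \<Rightarrow> (((nat \<Rightarrow> 'a::field) + (nat \<Rightarrow> 'a)) \<times> ((nat \<Rightarrow> 'a) + (nat \<Rightarrow> 'a))) set" where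
  "wenger_adj p m =
     (let E = {(Inl P, Inr L) | P L. P \<in> coord_vectors m \<and> L \<in> coord_vectors m \<and>
                                     wenger_incident p m P L}
      in E \<union> E\<inverse>)"

section \<open>Connected components and adjacency matrices\<close>

definition connected_components_of_graph :: "'v set \<Rightarrow> ('v \<times> 'v) set \<Rightarrow> 'v set set" where
  "connected_components_of_graph V E = V // {(u, v) \<in> V \<times> V. (u, v) \<in> E\<^sup>*}"

text \<open>
  The vertices are listed in the order \<open>vs\<close>. The entries are complex so that the spectrum
  consists of all eigenvalues.
\<close>

definition adjacency_matrix :: "'v list \<Rightarrow> ('v \<times> 'v) set \<Rightarrow> complex mat" where
  "adjacency_matrix vs E =
     mat (length vs) (length vs) (\<lambda>(i, j). if (vs ! i, vs ! j) \<in> E then 1 else 0)"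

definition eigenvalue_multiplicity :: "complex mat \<Rightarrow> complex \<Rightarrow> nat" where
  "eigenvalue_multiplicity A x = order x (char_poly A)"

section \<open>The multiplicity parameters\<close>

definition rank_quotient :: "nat \<Rightarrow> nat \<Rightarrow> nat \<Rightarrow> real" where
  "rank_quotient p e i =
     (\<Prod>j<e-i. (real p ^ e - real p ^ j)\<^sup>2) / (\<Prod>j<e-i. (real p ^ (e - i) - real p ^ j))"

text \<open>\<open>n_pow p e i\<close> is \<open>n\<close> with index \<open>p ^ i\<close>.\<close>

definition n_pow :: "nat \<Rightarrow> nat \<Rightarrow> nat \<Rightarrow> real" where
  "n_pow p e i = real p ^ (e - i) * rank_quotient p e i"

text \<open>
  \<open>n_zero\<close> counts zeros on one side of the bipartition: with biadjacency matrix \<open>N\<close>, the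
  kernels of \<open>N\<close> and of its transpose each have dimension \<open>q ^ (m - e) * n_zero p e\<close>, and
  each contributes to the eigenvalue \<open>0\<close> of the adjacency matrix. Equivalently, \<open>0\<close> is
  counted as the pair \<open>\<plusminus>0\<close>. Its multiplicity as an eigenvalue of the adjacency matrix, which
  has \<open>2 * q ^ (m + 1)\<close> rows, is therefore \<open>2 * q ^ (m - e) * n_zero p e\<close>. For \<open>p = 2\<close> and
  \<open>e = m = 1\<close> the graph is the 8-cycle, \<open>n_zero 2 1 = 1\<close>, and the multiplicity of \<open>0\<close> is 2.
\<close>

definition n_zero :: "nat \<Rightarrow> nat \<Rightarrow> real" where
  "n_zero p e = (\<Sum>i=1..e. (real p ^ e - real p ^ (e - i)) * rank_quotient p e i)"

end

theory Submission
  imports Defs "HOL-Number_Theory.Cong"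
begin

text \<open>
  Two steps of a walk translate a point by a vector \<open>(y, l y, l y\<^sup>p, \<dots>)\<close> independent of the point, so
  \<open>N N\<^sup>T\<close>, for the biadjacency matrix \<open>N\<close>, is diagonalised by the characters
  \<open>x \<mapsto> \<chi>(b\<^sub>1 x\<^sub>1 + \<dots>)\<close> of the group of points. With \<open>f\<^sub>b(y) = b\<^sub>2 y + b\<^sub>3 y\<^sup>p + \<dots>\<close> and
  \<open>K = ker f\<^sub>b\<close>, the eigenvalue at \<open>b\<close> is \<open>q |K|\<close> if \<open>y \<mapsto> \<chi>(b\<^sub>1 y)\<close> is trivial on \<open>K\<close>, which holds
  for \<open>q / |K|\<close> values of \<open>b\<^sub>1\<close>, and \<open>0\<close> otherwise. The maps \<open>f\<^sub>b\<close> run \<open>q ^ (m - e)\<close> times through all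
  linear maps over the prime field, and those with \<open>|K| = p ^ i\<close> are counted as matrices of rank
  \<open>e - i\<close>. The bipartite structure turns an eigenvalue \<open>d\<close> of \<open>N N\<^sup>T\<close> into \<open>\<plusminus>\<surd>d\<close>. Summing the
  characters over the points of one component shows that the number of components is the
  multiplicity of \<open>q\<^sup>2\<close>.
\<close>

section \<open>Matrices indexed by lists\<close>

text \<open>Indexing by list elements turns matrix products into sums over sets and lets rows and
  columns have different types, here vertices and characters.\<close>

definition kernel_mat :: "'r list \<Rightarrow> 'c list \<Rightarrow> ('r \<Rightarrow> 'c \<Rightarrow> 'k) \<Rightarrow> 'k mat" where
  "kernel_mat rs cs f = mat (length rs) (length cs) (\<lambda>(i, j). f (rs ! i) (cs ! j))"

lemma kernel_mat_carrier [simp]: "kernel_mat rs cs f \<in> carrier_mat (length rs) (length cs)"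
  by (simp add: kernel_mat_def)

lemma kernel_mat_dim [simp]:
  "dim_row (kernel_mat rs cs f) = length rs" "dim_col (kernel_mat rs cs f) = length cs"
  by (simp_all add: kernel_mat_def)

lemma kernel_mat_cong:
  "(\<And>r c. r \<in> set rs \<Longrightarrow> c \<in> set cs \<Longrightarrow> f r c = g r c) \<Longrightarrow> kernel_mat rs cs f = kernel_mat rs cs g"
  by (rule eq_matI) (auto simp: kernel_mat_def)

lemma kernel_mat_mult:
  assumes "distinct cs"
  shows "kernel_mat rs cs f * kernel_mat cs ds g =
    kernel_mat rs ds (\<lambda>r d. \<Sum>c\<in>set cs. f r c * g c d)"
proof (rule eq_matI)
  fix i j assume "i < dim_row (kernel_mat rs ds (\<lambda>r d. \<Sum>c\<in>set cs. f r c * g c d))"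
    "j < dim_col (kernel_mat rs ds (\<lambda>r d. \<Sum>c\<in>set cs. f r c * g c d))"
  moreover have "(\<Sum>c\<in>set cs. f r c * g c d) = (\<Sum>k = 0..<length cs. f r (cs ! k) * g (cs ! k) d)" for r d
    using sum.reindex_bij_betw[OF bij_betw_nth[OF assms refl refl], of "\<lambda>c. f r c * g c d"]
    by (simp add: atLeast0LessThan)
  ultimately show "(kernel_mat rs cs f * kernel_mat cs ds g) $$ (i, j) =
      kernel_mat rs ds (\<lambda>r d. \<Sum>c\<in>set cs. f r c * g c d) $$ (i, j)"
    by (simp add: kernel_mat_def scalar_prod_def)
qed (auto simp: kernel_mat_def)

lemma kernel_mat_one:
  "distinct rs \<Longrightarrow> kernel_mat rs rs (\<lambda>x y. of_bool (x = y)) = 1\<^sub>m (length rs)"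
  by (rule eq_matI) (auto simp: kernel_mat_def nth_eq_iff_index_eq)

text \<open>\<open>F\<close> is a change of basis with inverse \<open>G\<close>, and
  \<open>K F = F D\<close> makes \<open>K\<close> and \<open>D\<close> similar. Both lists have the
  same length, so the one-sided inverse \<open>F G = 1\<close> is two-sided.\<close>

lemma char_poly_kernel_mat_intertwine:
  fixes F :: "'v \<Rightarrow> 'b \<Rightarrow> 'k::field"
  assumes dist: "distinct vs" "distinct bs" and len: "length bs = length vs"
    and FG: "\<And>v w. v \<in> set vs \<Longrightarrow> w \<in> set vs \<Longrightarrow> (\<Sum>b\<in>set bs. F v b * G b w) = of_bool (v = w)"
    and KF: "\<And>v b. v \<in> set vs \<Longrightarrow> b \<in> set bs \<Longrightarrow>
      (\<Sum>w\<in>set vs. K v w * F w b) = (\<Sum>c\<in>set bs. F v c * D c b)"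
  shows "char_poly (kernel_mat vs vs K) = char_poly (kernel_mat bs bs D)"
proof -
  let ?n = "length vs"
  let ?F = "kernel_mat vs bs F" and ?G = "kernel_mat bs vs G"
  let ?K = "kernel_mat vs vs K" and ?D = "kernel_mat bs bs D"
  have car: "?F \<in> carrier_mat ?n ?n" "?G \<in> carrier_mat ?n ?n" "?K \<in> carrier_mat ?n ?n"
    "?D \<in> carrier_mat ?n ?n"
    using kernel_mat_carrier[of vs bs F] kernel_mat_carrier[of bs vs G] kernel_mat_carrier[of bs bs D] len
    by auto
  have 1: "?F * ?G = 1\<^sub>m ?n"
    unfolding kernel_mat_mult[OF dist(2)] kernel_mat_one[OF dist(1), symmetric]
    by (rule kernel_mat_cong) (rule FG)
  have 2: "?K * ?F = ?F * ?D"
    unfolding kernel_mat_mult[OF dist(2)] kernel_mat_mult[OF dist(1)]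
    by (rule kernel_mat_cong) (rule KF)
  have "?K = ?K * (?F * ?G)"
    using car 1 by simp
  also have "\<dots> = ?F * ?D * ?G"
    using car 2 assoc_mult_mat[of ?K ?n ?n ?F ?n ?G ?n] by simp
  finally have "?K = ?F * ?D * ?G" .
  then have "similar_mat ?K ?D"
    using car 1 mat_mult_left_right_inverse[OF car(1,2) 1]
    by (intro similar_matI[of ?K ?D ?F ?G ?n]) auto
  then show ?thesis
    by (rule char_poly_similar)
qed

text \<open>The columns of \<open>F\<close> are eigenvectors of \<open>K\<close>, and
  \<open>F G = 1\<close> says that they form a basis.\<close>

lemma char_poly_kernel_mat_diagonal:
  fixes F :: "'v \<Rightarrow> 'b \<Rightarrow> 'k::field"
  assumes dist: "distinct vs" "distinct bs" and len: "length bs = length vs"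
    and FG: "\<And>v w. v \<in> set vs \<Longrightarrow> w \<in> set vs \<Longrightarrow> (\<Sum>b\<in>set bs. F v b * G b w) = of_bool (v = w)"
    and KF: "\<And>v b. v \<in> set vs \<Longrightarrow> b \<in> set bs \<Longrightarrow> (\<Sum>w\<in>set vs. K v w * F w b) = F v b * d b"
  shows "char_poly (kernel_mat vs vs K) = (\<Prod>b\<in>set bs. [:- d b, 1:])"
proof -
  let ?D = "kernel_mat bs bs (\<lambda>b c. of_bool (b = c) * d b)"
  have eq: "of_bool P * x = (if P then x else 0)" "x * (if P then y else 0) = (if P then x * y else 0)"
    for P and x y :: 'k by auto
  have "char_poly (kernel_mat vs vs K) = char_poly ?D"
    using assms by (intro char_poly_kernel_mat_intertwine[of _ _ F G]) (auto simp: eq)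
  also have "\<dots> = (\<Prod>a\<leftarrow>diag_mat ?D. [:- a, 1:])"
    using dist(2) by (intro char_poly_upper_triangular[of _ "length bs"])
      (auto simp: kernel_mat_def nth_eq_iff_index_eq)
  also have "diag_mat ?D = map d bs"
    by (rule nth_equalityI) (auto simp: diag_mat_def kernel_mat_def)
  also have "(\<Prod>a\<leftarrow>map d bs. [:- a, 1:]) = (\<Prod>b\<in>set bs. [:- d b, 1:])"
    using dist(2) by (simp add: prod.distinct_set_conv_list o_def)
  finally show ?thesis .
qed

text \<open>The intertwining matrix is a permutation matrix. This frees the spectrum from the order
  in which the vertices are listed.\<close>

lemma char_poly_kernel_mat_reorder:
  fixes K :: "'v \<Rightarrow> 'v \<Rightarrow> 'k::field"
  assumes "distinct vs" "distinct ws" "set vs = set ws"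
  shows "char_poly (kernel_mat vs vs K) = char_poly (kernel_mat ws ws K)"
proof -
  have eq: "of_bool P * x = (if P then x else 0)" "x * of_bool P = (if P then x else 0)"
    for P and x :: 'k by auto
  show ?thesis
    using assms
    by (intro char_poly_kernel_mat_intertwine[of _ _ "\<lambda>v w. of_bool (v = w)" "\<lambda>v w. of_bool (v = w)"])
      (auto simp: eq distinct_card[symmetric])
qed

text \<open>The Schur complement of \<open>k I\<close> turns the characteristic polynomial at \<open>k\<close> into that of
  \<open>N M\<close> at \<open>k\<^sup>2\<close>.\<close>

lemma poly_char_poly_bipartite:
  fixes N M :: "'k::field mat"
  assumes N: "N \<in> carrier_mat n n" and M: "M \<in> carrier_mat n n"
  shows "poly (char_poly (four_block_mat (0\<^sub>m n n) N M (0\<^sub>m n n))) k = poly (char_poly (N * M)) (k\<^sup>2)"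
proof -
  let ?A = "four_block_mat (0\<^sub>m n n) N M (0\<^sub>m n n)"
  have A: "?A \<in> carrier_mat (n + n) (n + n)"
    by (rule four_block_carrier_mat) auto
  have "poly (char_poly ?A) k = det (- (char_matrix ?A k))"
    by (rule char_poly_matrix[OF A])
  also have "- (char_matrix ?A k) = four_block_mat (k \<cdot>\<^sub>m 1\<^sub>m n) (-N) (-M) (k \<cdot>\<^sub>m 1\<^sub>m n)"
    by (rule eq_matI) (use N M in \<open>auto simp: char_matrix_def\<close>)
  \<comment> \<open>The block formula needs the two lower blocks to commute, which holds because one
    of them is scalar.\<close>
  also have "det \<dots> = det ((k \<cdot>\<^sub>m 1\<^sub>m n) * (k \<cdot>\<^sub>m 1\<^sub>m n) - (- N) * (- M))"
    by (rule det_four_block_mat) (use N M in auto)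
  also have "(k \<cdot>\<^sub>m 1\<^sub>m n) * (k \<cdot>\<^sub>m 1\<^sub>m n) - (- N) * (- M) = - (char_matrix (N * M) (k\<^sup>2))"
    by (rule eq_matI) (use N M in \<open>auto simp: char_matrix_def power2_eq_square\<close>)
  also have "det \<dots> = poly (char_poly (N * M)) (k\<^sup>2)"
    by (rule char_poly_matrix[of _ n, symmetric]) (use N M in auto)
  finally show ?thesis .
qed

lemma kernel_mat_sum_type:
  "kernel_mat (map Inl ps @ map Inr ls) (map Inl ps @ map Inr ls) K =
    four_block_mat (kernel_mat ps ps (\<lambda>x y. K (Inl x) (Inl y))) (kernel_mat ps ls (\<lambda>x y. K (Inl x) (Inr y)))
      (kernel_mat ls ps (\<lambda>x y. K (Inr x) (Inl y))) (kernel_mat ls ls (\<lambda>x y. K (Inr x) (Inr y)))"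
  by (rule eq_matI) (auto simp: kernel_mat_def nth_append)

text \<open>The roots \<open>z\<close> and \<open>- z\<close> of \<open>x ^ 2 - z ^ 2\<close>
  coincide exactly at 0. This is the source of the factor 2 in the multiplicity of the eigenvalue
  0.\<close>

lemma order_square_minus:
  fixes z :: complex
  shows "order z [:- d, 0, 1:] = (if d = z\<^sup>2 then if z = 0 then 2 else 1 else 0)"
proof (cases "d = z\<^sup>2")
  case True
  have eq: "[:- d, 0, 1:] = [:- z, 1:] * [:z, 1:]"
    using True by (simp add: power2_eq_square)
  have "order z [:- z, 1:] = 1"
    using order_power_n_n[of z 1] by simp
  moreover have "order z [:z, 1:] = (if z = 0 then 1 else 0)"
    using order_power_n_n[of 0 1] by (auto intro: order_0I)
  ultimately show ?thesis
    using True unfolding eq by (subst order_mult) (auto simp: eq[symmetric])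
qed (auto intro!: order_0I simp: power2_eq_square)

lemma order_prod_square_minus:
  fixes z :: complex and d :: "'b \<Rightarrow> complex"
  assumes "finite S"
  shows "order z (\<Prod>b\<in>S. [:- d b, 0, 1:]) = card {b \<in> S. d b = z\<^sup>2} * (if z = 0 then 2 else 1)"
proof -
  have "order z (\<Prod>b\<in>S. [:- d b, 0, 1:]) = (\<Sum>b\<in>S. order z [:- d b, 0, 1:])"
    using assms
  proof (induction S)
    case (insert b S)
    then have "[:- d b, 0, 1:] * (\<Prod>b\<in>S. [:- d b, 0, 1:]) \<noteq> 0"
      by (auto simp del: mult_pCons_left)
    then show ?case
      using insert by (simp add: order_mult del: mult_pCons_left)
  qed simp
  also have "\<dots> = (\<Sum>b\<in>S. if d b = z\<^sup>2 then if z = 0 then 2 else 1 else 0)"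
    unfolding order_square_minus ..
  also have "\<dots> = card {b \<in> S. d b = z\<^sup>2} * (if z = 0 then 2 else 1)"
    using assms by (simp add: sum.If_cases Int_def)
  finally show ?thesis .
qed

section \<open>Linear maps over the prime field\<close>

lemma prime_CHAR_finite_field: "prime CHAR('a::{field,finite})"
  by (intro prime_CHAR_semidom finite_imp_CHAR_pos) simp

text \<open>Natural numbers serve as scalars of the prime field below; this one supplies
  negation.\<close>

lemma of_nat_CHAR_minus_1: "of_nat (CHAR('a) - 1) = (-1 :: 'a::{field,finite})"
proof -
  have "Suc 0 \<le> CHAR('a)"
    using prime_gt_0_nat[OF prime_CHAR_finite_field[where 'a='a]] by simp
  then show ?thesis
    by (simp add: of_nat_diff)
qed

section \<open>Additive subgroups and spans over the prime field\<close>

definition additive_subgroup :: "'a::ab_group_add set \<Rightarrow> bool" where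
  "additive_subgroup H \<longleftrightarrow> 0 \<in> H \<and> (\<forall>x\<in>H. \<forall>y\<in>H. x - y \<in> H)"

lemma additive_subgroupD:
  assumes "additive_subgroup H"
  shows "0 \<in> H" "x \<in> H \<Longrightarrow> y \<in> H \<Longrightarrow> x - y \<in> H" "x \<in> H \<Longrightarrow> - x \<in> H"
    "x \<in> H \<Longrightarrow> y \<in> H \<Longrightarrow> x + y \<in> H"
proof -
  show z: "0 \<in> H" and d: "x \<in> H \<Longrightarrow> y \<in> H \<Longrightarrow> x - y \<in> H" for x y
    using assms by (auto simp: additive_subgroup_def)
  show n: "x \<in> H \<Longrightarrow> - x \<in> H" for x
    using d[OF z, of x] by simp
  show "x \<in> H \<Longrightarrow> y \<in> H \<Longrightarrow> x + y \<in> H"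
    using d[of x "- y"] n by simp
qed

lemma additive_subgroup_of_nat_mult:
  fixes x :: "'a::ring_1"
  assumes "additive_subgroup H" "x \<in> H"
  shows "of_nat k * x \<in> H"
  by (induction k) (auto simp: distrib_right additive_subgroupD[OF assms(1)] assms(2))

text \<open>A multiplier prime to the characteristic has an inverse modulo it, so multiplication by
  it can be undone inside \<open>H\<close>.\<close>

lemma additive_subgroup_of_nat_multD:
  fixes x :: "'a::{field,finite}"
  assumes H: "additive_subgroup H" and "of_nat k * x \<in> H" and "\<not> CHAR('a) dvd k"
  shows "x \<in> H"
proof -
  have "coprime k CHAR('a)"
    using assms(3) prime_imp_coprime[OF prime_CHAR_finite_field] by (metis coprime_commute)
  then obtain j where "[k * j = 1] (mod CHAR('a))"
    using cong_solve_coprime_nat by auto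
  then have "of_nat (k * j) = (of_nat 1 :: 'a)"
    by (simp only: of_nat_eq_iff_cong_CHAR)
  then have "of_nat (k * j) * x = x"
    by (simp only: of_nat_1 mult_1)
  then have "of_nat j * (of_nat k * x) = x"
    by (simp add: mult_ac)
  then show ?thesis
    using additive_subgroup_of_nat_mult[OF H assms(2), of j] by (simp only:)
qed

text \<open>The linear span over the prime subfield, with natural numbers standing for the scalars
  so that no separate type of scalars is involved.\<close>

fun prime_span :: "'a::semiring_1 list \<Rightarrow> 'a set" where
  "prime_span [] = {0}"
| "prime_span (w # ws) = {of_nat k * w + s | k s. s \<in> prime_span ws}"

lemma additive_subgroup_prime_span: "additive_subgroup (prime_span (ws :: 'a::{field,finite} list))"
proof (induction ws)
  case Nil
  show ?case by (simp add: additive_subgroup_def)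
next
  case (Cons w ws)
  note H = additive_subgroupD[OF Cons]
  have "0 \<in> prime_span (w # ws)"
    using H(1) by (force intro: exI[of _ 0])
  moreover have "of_nat k * w + s - (of_nat l * w + t) \<in> prime_span (w # ws)"
    if "s \<in> prime_span ws" "t \<in> prime_span ws" for k l s t
  proof -
    have "of_nat k * w + s - (of_nat l * w + t) = of_nat (k + (CHAR('a) - 1) * l) * w + (s - t)"
      unfolding of_nat_add of_nat_mult of_nat_CHAR_minus_1 by (simp add: algebra_simps)
    then show ?thesis
      using H(2)[OF that] by (simp only: prime_span.simps mem_Collect_eq) blast
  qed
  ultimately show ?case
    unfolding additive_subgroup_def by fastforce
qed

lemma prime_span_Cons_mem:
  fixes ws :: "'a::{field,finite} list"
  assumes "w \<in> prime_span ws"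
  shows "prime_span (w # ws) = prime_span ws"
proof
  note H = additive_subgroup_prime_span[of ws]
  show "prime_span (w # ws) \<subseteq> prime_span ws"
    using additive_subgroup_of_nat_mult[OF H assms] additive_subgroupD(4)[OF H] by auto
  show "prime_span ws \<subseteq> prime_span (w # ws)"
    by (force intro: exI[of _ 0])
qed

text \<open>The class of \<open>w\<close> modulo \<open>H\<close> has order \<open>CHAR('a)\<close>.
  This gives unique coefficients in spans and later makes the constructed character well
  defined.\<close>

lemma of_nat_mult_cancel_mod_subgroup:
  fixes w :: "'a::{field,finite}"
  assumes H: "additive_subgroup H" and w: "w \<notin> H"
    and "of_nat k * w - of_nat l * w \<in> H"
  shows "[k = l] (mod CHAR('a))"
proof -
  \<comment> \<open>Subtraction on naturals is truncated, so one order of \<open>k\<close> and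
    \<open>l\<close> is treated first and the other follows by symmetry.\<close>
  have *: "[k = l] (mod CHAR('a))" if "of_nat k * w - of_nat l * w \<in> H" "l \<le> k" for k l :: nat
  proof -
    have "of_nat (k - l) * w \<in> H"
      using that by (simp add: of_nat_diff left_diff_distrib)
    then have "CHAR('a) dvd k - l"
      using additive_subgroup_of_nat_multD[OF H] w by blast
    then show ?thesis
      using that(2) by (simp add: cong_altdef_nat)
  qed
  show ?thesis
  proof (cases "l \<le> k")
    case False
    have "of_nat l * w - of_nat k * w \<in> H"
      using additive_subgroupD(3)[OF H assms(3)] by simp
    then show ?thesis
      using *[of l k] False by (simp add: cong_sym_eq)
  qed (use * assms(3) in auto)
qed

text \<open>Each element of the larger span is \<open>of_nat k * w + s\<close> for exactly one pair
  of a reduced coefficient \<open>k < CHAR('a)\<close> and an element \<open>s\<close> of the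
  smaller span.\<close>

lemma card_prime_span_Cons:
  fixes ws :: "'a::{field,finite} list"
  assumes w: "w \<notin> prime_span ws"
  shows "card (prime_span (w # ws)) = CHAR('a) * card (prime_span ws)"
proof -
  let ?S = "prime_span ws" and ?p = "CHAR('a)"
  note H = additive_subgroup_prime_span[of ws]
  have "bij_betw (\<lambda>(k, s). of_nat k * w + s) ({..<?p} \<times> ?S) (prime_span (w # ws))"
    unfolding bij_betw_def
  proof
    show "inj_on (\<lambda>(k, s). of_nat k * w + s) ({..<?p} \<times> ?S)"
    proof (rule inj_onI, clarsimp)
      fix k s l t assume *: "k < ?p" "l < ?p" "s \<in> ?S" "t \<in> ?S" "of_nat k * w + s = of_nat l * w + t"
      have "of_nat k * w - of_nat l * w = t - s"
        using *(5) by (simp add: algebra_simps)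
      then have "[k = l] (mod ?p)"
        using of_nat_mult_cancel_mod_subgroup[OF H w] additive_subgroupD(2)[OF H *(4,3)] by simp
      then have "k = l"
        using * by (simp add: cong_def)
      then show "k = l \<and> s = t"
        using * by simp
    qed
    show "(\<lambda>(k, s). of_nat k * w + s) ` ({..<?p} \<times> ?S) = prime_span (w # ws)"
    proof
      show "prime_span (w # ws) \<subseteq> (\<lambda>(k, s). of_nat k * w + s) ` ({..<?p} \<times> ?S)"
      proof
        fix x assume "x \<in> prime_span (w # ws)"
        then obtain k s where x: "x = of_nat k * w + s" "s \<in> ?S" by auto
        have "(of_nat k :: 'a) = of_nat (k mod ?p)"
          by (simp only: of_nat_eq_iff_cong_CHAR) (simp add: cong_def)
        moreover have "k mod ?p < ?p"
          using prime_gt_0_nat[OF prime_CHAR_finite_field[where 'a='a]] by simp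
        ultimately show "x \<in> (\<lambda>(k, s). of_nat k * w + s) ` ({..<?p} \<times> ?S)"
          using x by force
      qed
    qed auto
  qed
  then show ?thesis
    by (simp add: bij_betw_same_card[symmetric])
qed

lemma card_prime_span: "\<exists>r. card (prime_span (ws :: 'a::{field,finite} list)) = CHAR('a) ^ r"
proof (induction ws)
  case Nil
  show ?case by (auto intro: exI[of _ 0])
next
  case (Cons w ws)
  then obtain r where "card (prime_span ws) = CHAR('a) ^ r" by blast
  then show ?case
    using card_prime_span_Cons[of w ws] prime_span_Cons_mem[of w ws] power_Suc[of "CHAR('a)" r]
    by metis
qed

text \<open>The field is the span of a list of all its elements, so its size is a power of the
  characteristic.\<close>

lemma card_finite_field: "\<exists>e. card (UNIV :: 'a::{field,finite} set) = CHAR('a) ^ e"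
proof -
  have "set ws \<subseteq> prime_span ws" for ws :: "'a list"
  proof (induction ws)
    case (Cons w ws)
    have "w = of_nat 1 * w + 0" "0 \<in> prime_span ws"
      using additive_subgroupD(1)[OF additive_subgroup_prime_span] by auto
    then have "w \<in> prime_span (w # ws)"
      unfolding prime_span.simps by blast
    moreover have "prime_span ws \<subseteq> prime_span (w # ws)"
      by (force intro: exI[of _ 0])
    ultimately show ?case
      using Cons by auto
  qed simp
  moreover obtain ws where "set ws = (UNIV :: 'a set)"
    using finite_list[OF finite_UNIV] by blast
  ultimately have "prime_span ws = UNIV"
    by blast
  then show ?thesis
    using card_prime_span[of ws] by simp
qed

text \<open>Greedy choice: as long as the span is smaller than the field, some element lies outside,
  and adding it multiplies the size by \<open>CHAR('a)\<close>.\<close>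

lemma ex_prime_basis:
  assumes q: "card (UNIV :: 'a::{field,finite} set) = CHAR('a) ^ e"
  obtains vs :: "'a::{field,finite} list" where "length vs = e" "prime_span vs = UNIV"
proof -
  have p: "CHAR('a) > 1"
    using prime_gt_1_nat[OF prime_CHAR_finite_field] .
  have "\<exists>vs :: 'a list. length vs = r \<and> card (prime_span vs) = CHAR('a) ^ r" if "r \<le> e" for r
    using that
  proof (induction r)
    case (Suc r)
    then obtain ws :: "'a list" where ws: "length ws = r" "card (prime_span ws) = CHAR('a) ^ r"
      by auto
    have "card (prime_span ws) < card (UNIV :: 'a set)"
      using ws q p Suc.prems by (simp add: power_strict_increasing_iff)
    then obtain w where "w \<notin> prime_span ws"
      by (metis UNIV_eq_I less_irrefl)
    then show ?case
      using ws card_prime_span_Cons[of w ws] by (intro exI[of _ "w # ws"]) auto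
  qed auto
  then obtain vs :: "'a list" where "length vs = e" "card (prime_span vs) = CHAR('a) ^ e" by blast
  then show ?thesis
    using that q card_subset_eq[of UNIV "prime_span vs"] by simp
qed

text \<open>A new head either lies in the span of the tail, which keeps the rank, or outside it,
  which raises the rank by one. The two kinds of choices give the two summands.\<close>

lemma card_lists_prime_span_Suc:
  fixes d r :: nat
  assumes q: "card (UNIV :: 'a::{field,finite} set) = CHAR('a) ^ e"
  defines "M \<equiv> \<lambda>d r. {ws :: 'a::{field,finite} list. length ws = d \<and> card (prime_span ws) = CHAR('a) ^ r}"
  shows "real (card (M (Suc d) (Suc r))) =
      real (card (M d (Suc r))) * real CHAR('a) ^ Suc r +
      real (card (M d r)) * (real CHAR('a) ^ e - real CHAR('a) ^ r)"
    and "card (M (Suc d) 0) = card (M d 0)"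
proof -
  let ?p = "CHAR('a)"
  have p: "?p > 1"
    using prime_gt_1_nat[OF prime_CHAR_finite_field] .
  have fin: "finite (M d r)" for d r
    using finite_lists_length_eq[of "UNIV :: 'a set" d] unfolding M_def
    by (rule rev_finite_subset) auto
  have inj: "inj_on (\<lambda>(ws, w). w # ws) S" for S :: "('a list \<times> 'a) set"
    by (auto simp: inj_on_def)
  have same: "real (card (\<Union>ws\<in>M d r. (\<lambda>w. w # ws) ` prime_span ws)) =
      real (card (M d r)) * real ?p ^ r" for r
  proof -
    have "(\<Union>ws\<in>M d r. (\<lambda>w. w # ws) ` prime_span ws) = (\<lambda>(ws, w). w # ws) ` (SIGMA ws : M d r. prime_span ws)"
      by auto
    also have "card \<dots> = (\<Sum>ws\<in>M d r. card (prime_span ws))"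
      using fin by (simp add: card_image[OF inj] card_SigmaI)
    also have "\<dots> = card (M d r) * ?p ^ r"
      by (simp add: M_def)
    finally show ?thesis by simp
  qed
  have diff: "real (card (\<Union>ws\<in>M d r. (\<lambda>w. w # ws) ` (- prime_span ws))) =
      real (card (M d r)) * (real ?p ^ e - real ?p ^ r)"
  proof -
    have "(\<Union>ws\<in>M d r. (\<lambda>w. w # ws) ` (- prime_span ws)) = (\<lambda>(ws, w). w # ws) ` (SIGMA ws : M d r. - prime_span ws)"
      by auto
    also have "real (card \<dots>) = (\<Sum>ws\<in>M d r. real (card (- prime_span ws)))"
      using fin by (simp add: card_image[OF inj] card_SigmaI)
    also have "\<dots> = (\<Sum>ws\<in>M d r. real ?p ^ e - real ?p ^ r)"
    proof (rule sum.cong)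
      fix ws assume "ws \<in> M d r"
      then have c: "card (prime_span ws) = ?p ^ r"
        by (simp add: M_def)
      have "card (- prime_span ws) = ?p ^ e - ?p ^ r" "?p ^ r \<le> ?p ^ e"
        using c q card_mono[of UNIV "prime_span ws"] by (simp_all add: Compl_eq_Diff_UNIV card_Diff_subset)
      then show "real (card (- prime_span ws)) = real ?p ^ e - real ?p ^ r"
        by (simp add: of_nat_diff)
    qed simp
    finally show ?thesis by simp
  qed
  have rec: "w # ws \<in> M (Suc d) r \<longleftrightarrow> length ws = d \<and>
      (if w \<in> prime_span ws then card (prime_span ws) = ?p ^ r
       else ?p * card (prime_span ws) = ?p ^ r)" for w ws d r
    unfolding M_def using prime_span_Cons_mem[of w ws] card_prime_span_Cons[of w ws] by auto
  have cons: "ws \<in> M (Suc d) r \<Longrightarrow> \<exists>v vs. ws = v # vs" for ws d r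
    by (auto simp: M_def length_Suc_conv)
  have "M (Suc d) (Suc r) = (\<Union>ws\<in>M d (Suc r). (\<lambda>w. w # ws) ` prime_span ws) \<union>
      (\<Union>ws\<in>M d r. (\<lambda>w. w # ws) ` (- prime_span ws))" (is "_ = ?A \<union> ?B")
  proof (intro equalityI subsetI)
    fix ws assume *: "ws \<in> M (Suc d) (Suc r)"
    then obtain v vs where "ws = v # vs" using cons by blast
    then show "ws \<in> ?A \<union> ?B"
      using * p unfolding \<open>ws = v # vs\<close> rec by (auto simp: M_def split: if_splits)
  next
    fix ws assume "ws \<in> ?A \<union> ?B"
    then obtain v vs where "ws = v # vs"
      "vs \<in> M d (Suc r) \<and> v \<in> prime_span vs \<or> vs \<in> M d r \<and> v \<notin> prime_span vs"
      by auto
    then show "ws \<in> M (Suc d) (Suc r)"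
      using p by (auto simp: rec) (auto simp: M_def)
  qed
  moreover have "?A \<inter> ?B = {}"
    by auto
  moreover have "finite ?A" "finite ?B"
    using fin by auto
  ultimately have "real (card (M (Suc d) (Suc r))) = real (card ?A) + real (card ?B)"
    by (simp add: card_Un_disjoint)
  then show "real (card (M (Suc d) (Suc r))) =
      real (card (M d (Suc r))) * real CHAR('a) ^ Suc r +
      real (card (M d r)) * (real CHAR('a) ^ e - real CHAR('a) ^ r)"
    unfolding same diff .
  have "M (Suc d) 0 = (\<Union>ws\<in>M d 0. (\<lambda>w. w # ws) ` prime_span ws)" (is "_ = ?C")
  proof (intro equalityI subsetI)
    fix ws assume *: "ws \<in> M (Suc d) 0"
    then obtain v vs where "ws = v # vs" using cons by blast
    then show "ws \<in> ?C"
      using * p unfolding \<open>ws = v # vs\<close> rec by (auto simp: M_def split: if_splits)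
  next
    fix ws assume "ws \<in> ?C"
    then obtain v vs where "ws = v # vs" "vs \<in> M d 0" "v \<in> prime_span vs" by auto
    then show "ws \<in> M (Suc d) 0"
      using p by (auto simp: rec) (auto simp: M_def)
  qed
  then show "card (M (Suc d) 0) = card (M d 0)"
    using same[of 0] by simp
qed

text \<open>The number of \<open>d \<times> e\<close> matrices of rank \<open>r\<close> over \<open>F\<^sub>p\<close>: a list of \<open>d\<close> elements of the field
  is such a matrix, and the size of its span is \<open>p ^ r\<close>.\<close>

lemma card_lists_prime_span:
  assumes q: "card (UNIV :: 'a::{field,finite} set) = CHAR('a) ^ e"
  shows "real (card {ws :: 'a list. length ws = d \<and> card (prime_span ws) = CHAR('a) ^ r}) =
    (\<Prod>j<r. (real CHAR('a) ^ d - real CHAR('a) ^ j) * (real CHAR('a) ^ e - real CHAR('a) ^ j)) /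
    (\<Prod>j<r. real CHAR('a) ^ r - real CHAR('a) ^ j)"
proof -
  let ?p = "real CHAR('a)"
  have p: "CHAR('a) > 1"
    using prime_gt_1_nat[OF prime_CHAR_finite_field] .
  define P where "P n r = (\<Prod>j<r. ?p ^ n - ?p ^ j)" for n r
  have P_Suc: "P n (Suc r) = P n r * (?p ^ n - ?p ^ r)" for n r
    by (simp add: P_def)
  \<comment> \<open>The factor \<open>j = 0\<close> is split off and one factor \<open>?p\<close> is
    taken out of each of the \<open>r\<close> others, so that \<open>P (Suc d)\<close> can be
    compared with \<open>P d\<close>.\<close>
  have P_shift: "P (Suc n) (Suc r) = (?p ^ Suc n - 1) * ?p ^ r * P n r" for n r
  proof (induction r)
    case (Suc r)
    then show ?case
      by (simp only: P_Suc[of "Suc n" "Suc r"] P_Suc[of n r]) (simp add: algebra_simps)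
  qed (simp add: P_def)
  have P_diag: "P r r \<noteq> 0" for r
    using p by (auto simp: P_def)
  have "real (card {ws :: 'a list. length ws = d \<and> card (prime_span ws) = CHAR('a) ^ r}) =
      P d r * P e r / P r r"
  proof (induction d arbitrary: r)
    case 0
    have "(1 = CHAR('a) ^ r) = (r = 0)"
      by (subst eq_commute) (use p in simp)
    then have "{ws :: 'a list. length ws = 0 \<and> card (prime_span ws) = CHAR('a) ^ r} =
        (if r = 0 then {[]} else {})"
      by auto
    \<comment> \<open>For \<open>r > 0\<close> the factor \<open>j = 0\<close> is
      \<open>1 - 1\<close>, in agreement with the empty list having rank 0 only.\<close>
    moreover have "P 0 r = (if r = 0 then 1 else 0)"
      by (auto simp: P_def intro!: bexI[of _ 0])
    ultimately show ?case
      by (auto simp: P_def)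
  next
    case (Suc d)
    show ?case
    proof (cases r)
      case 0
      then show ?thesis
        using Suc.IH[of 0] card_lists_prime_span_Suc(2)[OF q, of d] by (simp add: P_def)
    next
      case (Suc s)
      have nz: "P s s \<noteq> 0" "?p ^ Suc s - 1 \<noteq> 0" "?p ^ s \<noteq> 0"
        using P_diag p power_gt1[of ?p s] by auto
      have "real (card {ws :: 'a list. length ws = Suc d \<and> card (prime_span ws) = CHAR('a) ^ r}) =
          P d (Suc s) * P e (Suc s) / P (Suc s) (Suc s) * ?p ^ Suc s +
          P d s * P e s / P s s * (?p ^ e - ?p ^ s)"
        unfolding Suc card_lists_prime_span_Suc(1)[OF q, of d s] Suc.IH ..
      also have "\<dots> = P d s * (?p ^ d - ?p ^ s) * P e (Suc s) /
          ((?p ^ Suc s - 1) * ?p ^ s * P s s) * ?p ^ Suc s + P d s * P e (Suc s) / P s s"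
        unfolding P_shift[of s s] P_Suc[of d s] P_Suc[of e s] by simp
      also have "\<dots> = (?p * (?p ^ d - ?p ^ s) + (?p ^ Suc s - 1)) * P d s * P e (Suc s) /
          ((?p ^ Suc s - 1) * P s s)"
        using nz by (simp add: field_simps)
      \<comment> \<open>With the common factors removed, the recursion comes down to this
        cancellation.\<close>
      also have "?p * (?p ^ d - ?p ^ s) + (?p ^ Suc s - 1) = ?p ^ Suc d - 1"
        by (simp add: algebra_simps)
      also have "(?p ^ Suc d - 1) * P d s * P e (Suc s) / ((?p ^ Suc s - 1) * P s s) =
          P (Suc d) (Suc s) * P e (Suc s) / P (Suc s) (Suc s)"
        unfolding P_shift using nz by (simp add: field_simps)
      finally show ?thesis
        unfolding Suc .
    qed
  qed
  then show ?thesis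
    by (simp add: P_def prod.distrib)
qed

section \<open>Additive maps and linearized polynomials\<close>

lemma additive_image_prime_span:
  fixes f :: "'a::ring_1 \<Rightarrow> 'a"
  assumes "additive f"
  shows "f ` prime_span ws = prime_span (map f ws)"
proof -
  interpret additive f by fact
  \<comment> \<open>Additivity alone gives linearity over the prime field.\<close>
  have mult: "f (of_nat k * w) = of_nat k * f w" for k w
    by (induction k) (simp_all add: distrib_right add zero)
  show ?thesis
  proof (induction ws)
    case (Cons w ws)
    have "f ` prime_span (w # ws) = {of_nat k * f w + t | k t. t \<in> f ` prime_span ws}"
    proof (intro equalityI subsetI)
      fix y assume "y \<in> {of_nat k * f w + t | k t. t \<in> f ` prime_span ws}"
      then obtain k s where "y = f (of_nat k * w + s)" "s \<in> prime_span ws"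
        by (auto simp: add mult)
      then show "y \<in> f ` prime_span (w # ws)"
        by (auto intro!: imageI)
    next
      fix y assume "y \<in> f ` prime_span (w # ws)"
      then obtain k s where "y = f (of_nat k * w + s)" "s \<in> prime_span ws"
        by auto
      then have "y = of_nat k * f w + f s" "f s \<in> f ` prime_span ws"
        by (simp_all add: add mult)
      then show "y \<in> {of_nat k * f w + t | k t. t \<in> f ` prime_span ws}"
        by blast
    qed
    then show ?case
      unfolding Cons by simp
  qed (simp add: zero)
qed

text \<open>Rank-nullity for finite groups: choosing one preimage per value identifies the domain
  with kernel times range.\<close>

lemma card_kernel_times_card_range:
  fixes f :: "'a::{ab_group_add,finite} \<Rightarrow> 'b::ab_group_add"
  assumes "additive f"
  shows "card {x. f x = 0} * card (range f) = card (UNIV :: 'a set)"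
proof -
  interpret additive f by fact
  have [simp]: "f (inv_into UNIV f (f x)) = f x" for x
    by (rule f_inv_into_f) simp
  have "bij_betw (\<lambda>(k, y). k + inv_into UNIV f y) ({x. f x = 0} \<times> range f) UNIV"
  proof (rule bij_betwI[of _ _ _ "\<lambda>x. (x - inv_into UNIV f (f x), f x)"])
  qed (auto simp: add diff)
  then show ?thesis
    by (simp add: bij_betw_same_card[symmetric])
qed

text \<open>This is the map \<open>f_b\<close> of the introduction. Coefficients keep their
  coordinate numbers, so that the index \<open>b\<close> of a character can be passed directly,
  while \<open>b 1\<close> acts separately.\<close>

definition linearized_poly :: "nat \<Rightarrow> nat \<Rightarrow> (nat \<Rightarrow> 'a::comm_ring_1) \<Rightarrow> 'a \<Rightarrow> 'a" where
  "linearized_poly p m c x = (\<Sum>k\<in>{2..m+1}. c k * x ^ (p ^ (k - 2)))"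

lemma additive_linearized_poly:
  fixes c :: "nat \<Rightarrow> 'a::{field,finite}"
  shows "additive (linearized_poly CHAR('a) m c)"
proof
  fix x y :: 'a
  have "(x + y) ^ (CHAR('a) ^ k) = x ^ (CHAR('a) ^ k) + y ^ (CHAR('a) ^ k)" for k
    by (rule freshmans_dream'[OF prime_CHAR_finite_field refl])
  then show "linearized_poly CHAR('a) m c (x + y) =
      linearized_poly CHAR('a) m c x + linearized_poly CHAR('a) m c y"
    by (simp add: linearized_poly_def distrib_left sum.distrib)
qed

text \<open>The polynomial has degree below \<open>CHAR('a) ^ e\<close> but vanishes on the whole
  field, so it is zero; its exponents are distinct, so each coefficient can be read off.\<close>

lemma linearized_poly_eq_0D:
  fixes c :: "nat \<Rightarrow> 'a::{field,finite}"
  assumes q: "card (UNIV :: 'a set) = CHAR('a) ^ e"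
    and zero: "\<And>x. linearized_poly CHAR('a) e c x = 0" and k: "k \<in> {2..e+1}"
  shows "c k = 0"
proof -
  let ?p = "CHAR('a)"
  have p: "?p > 1"
    using prime_gt_1_nat[OF prime_CHAR_finite_field] .
  define P where "P = (\<Sum>k\<in>{2..e+1}. monom (c k) (?p ^ (k - 2)))"
  have deg: "degree P < ?p ^ e"
    unfolding P_def
  proof (rule degree_sum_less)
    fix l assume "l \<in> {2..e+1}"
    then have "?p ^ (l - 2) < ?p ^ e"
      using p by (intro power_strict_increasing) auto
    then show "degree (monom (c l) (?p ^ (l - 2))) < ?p ^ e"
      using degree_monom_le[of "c l" "?p ^ (l - 2)"] by linarith
  qed (use p in simp)
  have "poly P x = 0" for x
    using zero[of x] by (simp only: P_def linearized_poly_def poly_sum poly_monom)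
  then have "P = 0"
    using card_poly_roots_bound[of P] deg q by fastforce
  have "coeff P (?p ^ (k - 2)) = (\<Sum>l\<in>{2..e+1}. if l = k then c l else 0)"
    unfolding P_def coeff_sum coeff_monom
  proof (rule sum.cong)
    fix l assume "l \<in> {2..e+1}"
    then have "?p ^ (l - 2) = ?p ^ (k - 2) \<longleftrightarrow> l = k"
      using k p by auto
    then show "(if ?p ^ (l - 2) = ?p ^ (k - 2) then c l else 0) = (if l = k then c l else 0)"
      by simp
  qed simp
  also have "\<dots> = c k"
    using k by simp
  finally show ?thesis
    using \<open>P = 0\<close> by simp
qed

text \<open>Once the coefficients of index above \<open>e + 1\<close> are fixed, the first \<open>e\<close> ones correspond
  bijectively to the images of a basis, so that linearized polynomials run through all
  additive maps, each being attained \<open>q ^ (m - e)\<close> times.\<close>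

lemma card_linearized_poly_kernel:
  assumes q: "card (UNIV :: 'a::{field,finite} set) = CHAR('a) ^ e" and "e \<le> m" and "i \<le> e"
  shows "card {c \<in> {2..m+1} \<rightarrow>\<^sub>E (UNIV :: 'a set).
      card {x. linearized_poly CHAR('a) m c x = 0} = CHAR('a) ^ i} =
    CHAR('a) ^ (e * (m - e)) *
    card {ws :: 'a list. length ws = e \<and> card (prime_span ws) = CHAR('a) ^ (e - i)}"
proof -
  let ?p = "CHAR('a)"
  let ?f = "\<lambda>c :: nat \<Rightarrow> 'a. linearized_poly ?p m c"
  have p: "?p > 1"
    using prime_gt_1_nat[OF prime_CHAR_finite_field] .
  obtain vs :: "'a list" where vs: "length vs = e" "prime_span vs = UNIV"
    using ex_prime_basis[OF q] .
  let ?C = "{2..m+1} \<rightarrow>\<^sub>E (UNIV :: 'a set)" and ?D = "{e+2..m+1} \<rightarrow>\<^sub>E (UNIV :: 'a set)"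
  let ?W = "{ws :: 'a list. length ws = e}"
  define \<phi> where "\<phi> c = (restrict c {e+2..m+1}, map (?f c) vs)" for c
  have range: "range (?f c) = prime_span (map (?f c) vs)" for c
    using additive_image_prime_span[OF additive_linearized_poly[of m c], of vs] vs(2) by simp
  \<comment> \<open>Rank-nullity turns the condition on the kernel into one on the span of the basis
    images.\<close>
  have kernel: "card {x. ?f c x = 0} = ?p ^ i \<longleftrightarrow> card (prime_span (map (?f c) vs)) = ?p ^ (e - i)" for c
  proof -
    have "card {x. ?f c x = 0} * card (prime_span (map (?f c) vs)) = ?p ^ i * ?p ^ (e - i)"
      using card_kernel_times_card_range[OF additive_linearized_poly[of m c]] q \<open>i \<le> e\<close>
      by (simp add: range power_add[symmetric])
    then show ?thesis
      using p by (metis mult_cancel1 mult_cancel2 power_not_zero not_one_less_zero)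
  qed
  have inj: "inj_on \<phi> ?C"
  proof (rule inj_onI)
    fix c d assume c: "c \<in> ?C" and d: "d \<in> ?C" and eq: "\<phi> c = \<phi> d"
    have rest: "c k = d k" if "k \<in> {e+2..m+1}" for k
      using eq that unfolding \<phi>_def by (metis prod.inject restrict_apply')
    \<comment> \<open>The high coefficients of \<open>c\<close> and \<open>d\<close> agree, so the
      difference of the two maps involves only the first \<open>e\<close> coefficients.\<close>
    let ?g = "linearized_poly ?p e (\<lambda>k. c k - d k)"
    have diff: "?g x = ?f c x - ?f d x" for x
    proof -
      have "{2..m+1} = {2..e+1} \<union> {e+2..m+1}"
        using \<open>e \<le> m\<close> by auto
      then have "?f b x = linearized_poly ?p e b x + (\<Sum>k\<in>{e+2..m+1}. b k * x ^ (?p ^ (k - 2)))" for b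
        unfolding linearized_poly_def by (simp only:) (rule sum.union_disjoint; auto)
      moreover have "(\<Sum>k\<in>{e+2..m+1}. c k * x ^ (?p ^ (k - 2))) =
          (\<Sum>k\<in>{e+2..m+1}. d k * x ^ (?p ^ (k - 2)))"
        using rest by (intro sum.cong) auto
      moreover have "?g x = linearized_poly ?p e c x - linearized_poly ?p e d x"
        by (simp add: linearized_poly_def left_diff_distrib sum_subtractf)
      ultimately show ?thesis
        by simp
    qed
    have "map ?g vs = replicate e 0"
      using eq vs(1) by (intro nth_equalityI) (auto simp: \<phi>_def diff map_eq_conv)
    moreover have "prime_span (replicate n 0) = {0 :: 'a}" for n
      by (induction n) auto
    ultimately have "range ?g = {0}"
      using additive_image_prime_span[OF additive_linearized_poly[of e "\<lambda>k. c k - d k"], of vs] vs(2)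
      by simp
    then have "?g x = 0" for x
      by blast
    from linearized_poly_eq_0D[OF q this] have "c k = d k" if "k \<in> {2..e+1}" for k
      using that by simp
    with rest have "c k = d k" if "k \<in> {2..m+1}" for k
      using that by (cases "k \<le> e + 1") auto
    then show "c = d"
      using c d by (intro PiE_ext)
  qed
  \<comment> \<open>Both sets have \<open>q ^ m\<close> elements, where \<open>q\<close> is the
    field size, so the injective \<open>\<phi>\<close> is also onto.\<close>
  have "card (?D \<times> ?W) = card ?C"
    using card_lists_length_eq[of "UNIV :: 'a set" e] \<open>e \<le> m\<close>
    by (simp add: card_cartesian_product card_funcsetE power_add[symmetric])
  moreover have "\<phi> ` ?C \<subseteq> ?D \<times> ?W"
    using vs(1) by (auto simp: \<phi>_def)
  moreover have "finite (?D \<times> ?W)"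
    using finite_lists_length_eq[of "UNIV :: 'a set" e] by (intro finite_cartesian_product finite_PiE) auto
  ultimately have surj: "\<phi> ` ?C = ?D \<times> ?W"
    using inj by (intro card_subset_eq) (simp_all add: card_image)
  let ?V = "{ws :: 'a list. length ws = e \<and> card (prime_span ws) = ?p ^ (e - i)}"
  have "\<phi> ` {c \<in> ?C. card {x. ?f c x = 0} = ?p ^ i} = {y \<in> \<phi> ` ?C. card (prime_span (snd y)) = ?p ^ (e - i)}"
    unfolding kernel by (auto simp: \<phi>_def)
  also have "\<dots> = ?D \<times> ?V"
    unfolding surj by auto
  finally have "\<phi> ` {c \<in> ?C. card {x. ?f c x = 0} = ?p ^ i} = ?D \<times> ?V" .
  moreover have "inj_on \<phi> {c \<in> ?C. card {x. ?f c x = 0} = ?p ^ i}"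
    using inj by (rule inj_on_subset) auto
  ultimately have "card {c \<in> ?C. card {x. ?f c x = 0} = ?p ^ i} = card (?D \<times> ?V)"
    using card_image[of \<phi> "{c \<in> ?C. card {x. ?f c x = 0} = ?p ^ i}"] by (simp only:)
  then show ?thesis
    using \<open>e \<le> m\<close> by (simp add: card_cartesian_product card_funcsetE q power_mult)
qed

section \<open>Additive characters\<close>

definition nontrivial_additive_character :: "('a::{field,finite} \<Rightarrow> complex) \<Rightarrow> bool" where
  "nontrivial_additive_character \<chi> \<longleftrightarrow>
     \<chi> 0 = 1 \<and> (\<forall>x y. \<chi> (x + y) = \<chi> x * \<chi> y) \<and> (\<exists>x. \<chi> x \<noteq> 1)"

text \<open>In a shortest spanning list the head \<open>w\<close> lies outside the span
  \<open>H\<close> of the tail. The coordinate of \<open>x\<close> along \<open>w\<close> modulo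
  \<open>H\<close> is a residue modulo the characteristic, and it becomes the exponent of a root of
  unity \<open>\<omega> \<noteq> 1\<close>.\<close>

lemma ex_nontrivial_additive_character:
  "\<exists>\<chi> :: 'a::{field,finite} \<Rightarrow> complex. nontrivial_additive_character \<chi>"
proof -
  let ?p = "CHAR('a)"
  have p: "?p > 1"
    using prime_gt_1_nat[OF prime_CHAR_finite_field] .
  have ex: "\<exists>vs :: 'a list. prime_span vs = UNIV"
    using card_finite_field[where 'a='a] ex_prime_basis[where 'a='a] by metis
  define vs where "vs = arg_min length (\<lambda>vs :: 'a list. prime_span vs = UNIV)"
  have vs: "prime_span vs = UNIV" and min: "\<And>ws :: 'a list. prime_span ws = UNIV \<Longrightarrow> length vs \<le> length ws"
    using arg_min_nat_lemma[of "\<lambda>vs :: 'a list. prime_span vs = UNIV" _ length] ex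
    unfolding vs_def by auto
  have "vs \<noteq> []"
  proof
    assume "vs = []"
    then have "(1 :: 'a) \<in> {0}"
      using vs by (metis UNIV_I prime_span.simps(1))
    then show False
      by simp
  qed
  then obtain w ws where ws: "vs = w # ws"
    by (cases vs) auto
  define H where "H = prime_span ws"
  have H: "additive_subgroup H"
    unfolding H_def by (rule additive_subgroup_prime_span)
  have w: "w \<notin> H"
    using min[of ws] prime_span_Cons_mem[of w ws] vs ws unfolding H_def by auto
  have "card {z :: complex. z ^ ?p = 1} = ?p"
    using p by (intro card_roots_unity_eq) simp
  then have "\<not> {z :: complex. z ^ ?p = 1} \<subseteq> {1}"
    using p card_mono[of "{1 :: complex}" "{z. z ^ ?p = 1}"] by auto
  then obtain \<omega> :: complex where \<omega>: "\<omega> ^ ?p = 1" "\<omega> \<noteq> 1"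
    by auto
  have cong: "\<omega> ^ k = \<omega> ^ l" if "[k = l] (mod ?p)" for k l
  proof -
    have "\<omega> ^ k = \<omega> ^ (k mod ?p)" for k
      using \<omega>(1) by (metis div_mult_mod_eq mult.commute mult_1 power_add power_mult power_one)
    then show ?thesis
      using that unfolding cong_def by metis
  qed
  \<comment> \<open>A choice of coordinate along \<open>w\<close>. It is determined only modulo
    \<open>?p\<close>, an ambiguity that \<open>\<omega> ^ ?p = 1\<close> removes.\<close>
  define \<kappa> where "\<kappa> x = (SOME k. x - of_nat k * w \<in> H)" for x
  have \<kappa>: "x - of_nat (\<kappa> x) * w \<in> H" for x
  proof -
    have "x \<in> prime_span (w # ws)"
      using vs ws by simp
    then obtain k s where "x = of_nat k * w + s" "s \<in> H"
      by (auto simp: H_def)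
    then have "x - of_nat k * w \<in> H"
      by simp
    then show ?thesis
      unfolding \<kappa>_def by (rule someI)
  qed
  have eq: "\<omega> ^ \<kappa> x = \<omega> ^ k" if "x - of_nat k * w \<in> H" for x k
  proof -
    have "of_nat (\<kappa> x) * w - of_nat k * w \<in> H"
      using additive_subgroupD(2)[OF H that \<kappa>[of x]] by simp
    then show ?thesis
      by (intro cong of_nat_mult_cancel_mod_subgroup[OF H w])
  qed
  have "\<omega> ^ \<kappa> 0 = 1"
    using eq[of 0 0] additive_subgroupD(1)[OF H] by simp
  moreover have "\<omega> ^ \<kappa> (x + y) = \<omega> ^ \<kappa> x * \<omega> ^ \<kappa> y" for x y
  proof -
    have "(x + y) - of_nat (\<kappa> x + \<kappa> y) * w = (x - of_nat (\<kappa> x) * w) + (y - of_nat (\<kappa> y) * w)"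
      by (simp add: algebra_simps)
    then show ?thesis
      using eq[of "x + y" "\<kappa> x + \<kappa> y"] additive_subgroupD(4)[OF H \<kappa>[of x] \<kappa>[of y]]
      by (simp only: power_add)
  qed
  moreover have "\<omega> ^ \<kappa> w \<noteq> 1"
    using eq[of w 1] additive_subgroupD(1)[OF H] \<omega>(2) by simp
  ultimately have "nontrivial_additive_character (\<lambda>x. \<omega> ^ \<kappa> x)"
    unfolding nontrivial_additive_character_def by blast
  then show ?thesis
    by blast
qed

lemma additive_subgroup_kernel: "additive f \<Longrightarrow> additive_subgroup {x. f x = 0}"
proof -
  assume "additive f"
  then interpret additive f .
  show ?thesis
    by (simp add: additive_subgroup_def zero diff)
qed

text \<open>Translating by some \<open>h\<close> with \<open>\<psi> h \<noteq> 1\<close> multiplies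
  the sum by \<open>\<psi> h\<close> without changing it, so it is 0.\<close>

lemma sum_character_subgroup:
  fixes \<psi> :: "'a::ab_group_add \<Rightarrow> complex"
  assumes H: "additive_subgroup H" and mult: "\<And>x y. \<psi> (x + y) = \<psi> x * \<psi> y"
  shows "(\<Sum>x\<in>H. \<psi> x) = (if \<forall>x\<in>H. \<psi> x = 1 then of_nat (card H) else 0)"
proof (cases "\<forall>x\<in>H. \<psi> x = 1")
  case False
  then obtain h where h: "h \<in> H" "\<psi> h \<noteq> 1"
    by blast
  have "bij_betw (\<lambda>x. h + x) H H"
    by (rule bij_betwI[of _ _ _ "\<lambda>x. x - h"]) (use h additive_subgroupD[OF H] in auto)
  then have "(\<Sum>x\<in>H. \<psi> x) = (\<Sum>x\<in>H. \<psi> (h + x))"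
    by (rule sum.reindex_bij_betw[symmetric])
  also have "\<dots> = \<psi> h * (\<Sum>x\<in>H. \<psi> x)"
    by (simp add: mult sum_distrib_left)
  finally have "(\<Sum>x\<in>H. \<psi> x) = 0"
    using h(2) by simp
  then show ?thesis
    by (simp only: False if_False)
qed simp

text \<open>Splits off the first coordinate: for the eigenvalues, the tail \<open>c\<close> fixes
  the linearized polynomial and \<open>x\<close> is then tested against its kernel.\<close>

lemma card_coord_vectors_Collect:
  "card {b \<in> coord_vectors m. Q b} =
    (\<Sum>c\<in>{2..m+1} \<rightarrow>\<^sub>E (UNIV :: 'a::finite set). card {x. Q (c(1 := x))})"
proof -
  let ?C = "{2..m+1} \<rightarrow>\<^sub>E (UNIV :: 'a set)"
  have insert: "{1..m+1} = insert 1 {2..m+1}"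
    by auto
  have "{b \<in> coord_vectors m. Q b} = (\<lambda>(x, c). c(1 := x)) ` (\<lambda>(c, x). (x, c)) ` (SIGMA c : ?C. {x. Q (c(1 := x))})"
    unfolding coord_vectors_def insert PiE_insert_eq by (force simp: image_iff)
  also have "card \<dots> = card ((\<lambda>(c, x). (x, c)) ` (SIGMA c : ?C. {x. Q (c(1 := x))}))"
    by (intro card_image inj_on_subset[OF inj_combinator[of 1 "{2..m+1}" "\<lambda>_. UNIV"]]) auto
  also have "\<dots> = card (SIGMA c : ?C. {x. Q (c(1 := x))})"
    by (intro card_image) (auto simp: inj_on_def)
  also have "\<dots> = (\<Sum>c\<in>?C. card {x. Q (c(1 := x))})"
    by (intro card_SigmaI) (auto intro: finite_PiE)
  finally show ?thesis .
qed

lemma linearized_poly_upd_1 [simp]: "linearized_poly p m (c(1 := x)) = linearized_poly p m c"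
  by (auto simp: linearized_poly_def fun_eq_iff intro!: sum.cong)

text \<open>\<open>rank_quotient\<close> with index \<open>i\<close> counts the
  \<open>e \<times> e\<close> matrices of rank \<open>e - i\<close>: for \<open>d = e\<close> the
  two products in the rank count merge into a square.\<close>

lemma real_card_linearized_poly_kernel:
  assumes q: "card (UNIV :: 'a::{field,finite} set) = CHAR('a) ^ e" and m: "e \<le> m" and i: "i \<le> e"
  shows "real (card {c \<in> {2..m+1} \<rightarrow>\<^sub>E (UNIV :: 'a set).
      card {x. linearized_poly CHAR('a) m c x = 0} = CHAR('a) ^ i}) =
    real ((CHAR('a) ^ e) ^ (m - e)) * rank_quotient CHAR('a) e i"
  unfolding card_linearized_poly_kernel[OF q m i] rank_quotient_def of_nat_mult
    card_lists_prime_span[OF q] power2_eq_square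
  by (simp add: power_mult)

lemma card_linearized_poly_kernel_power:
  assumes q: "card (UNIV :: 'a::{field,finite} set) = CHAR('a) ^ e"
  shows "\<exists>i\<le>e. card {x :: 'a. linearized_poly CHAR('a) m c x = 0} = CHAR('a) ^ i"
proof -
  have "card {x :: 'a. linearized_poly CHAR('a) m c x = 0} dvd CHAR('a) ^ e"
    using card_kernel_times_card_range[OF additive_linearized_poly[of m c]] unfolding q
    by (metis dvd_triv_left)
  then show ?thesis
    using divides_primepow_nat[OF prime_CHAR_finite_field[where 'a='a]] by blast
qed

section \<open>Characters of the group of points and their eigenvalues\<close>

definition pairing :: "nat \<Rightarrow> (nat \<Rightarrow> 'a) \<Rightarrow> (nat \<Rightarrow> 'a) \<Rightarrow> 'a::comm_ring_1" where
  "pairing m b v = (\<Sum>i\<in>{1..m+1}. b i * v i)"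

text \<open>One summand per two-step walk: \<open>l\<close> is the first coordinate of the line
  passed through, and \<open>y\<close> is the change in the first coordinate of the point.\<close>

definition character_eigenvalue :: "('a::{field,finite} \<Rightarrow> complex) \<Rightarrow> nat \<Rightarrow> nat \<Rightarrow> (nat \<Rightarrow> 'a) \<Rightarrow> complex" where
  "character_eigenvalue \<chi> p m b = (\<Sum>y\<in>UNIV. \<Sum>l\<in>UNIV. \<chi> (b 1 * y + l * linearized_poly p m b y))"

context
  fixes \<chi> :: "'a::{field,finite} \<Rightarrow> complex"
  assumes \<chi>: "nontrivial_additive_character \<chi>"
begin

lemma character_0 [simp]: "\<chi> 0 = 1" and character_add: "\<chi> (x + y) = \<chi> x * \<chi> y"
  using \<chi> by (auto simp: nontrivial_additive_character_def)

lemma character_minus_mult: "\<chi> (- x) * \<chi> x = 1"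
  using character_add[of "- x" x] by simp

lemma character_sum: "\<chi> (\<Sum>i\<in>I. f i) = (\<Prod>i\<in>I. \<chi> (f i))"
  by (induction I rule: infinite_finite_induct) (auto simp: character_add)

text \<open>Orthogonality: for \<open>a \<noteq> 0\<close> the product \<open>x * a\<close> runs
  through the whole field, on which \<open>\<chi>\<close> is nontrivial.\<close>

lemma sum_character_mult:
  "(\<Sum>x\<in>UNIV. \<chi> (x * a)) = (if a = 0 then of_nat (card (UNIV :: 'a set)) else 0)"
proof -
  have "(\<forall>x\<in>UNIV. \<chi> (x * a) = 1) \<longleftrightarrow> a = 0"
  proof
    assume *: "\<forall>x\<in>UNIV. \<chi> (x * a) = 1"
    show "a = 0"
    proof (rule ccontr)
      assume "a \<noteq> 0"
      then have "\<chi> y = 1" for y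
        using *[rule_format, of "y / a"] by simp
      then show False
        using \<chi> by (auto simp: nontrivial_additive_character_def)
    qed
  qed simp
  then show ?thesis
    by (subst sum_character_subgroup)
      (auto simp: additive_subgroup_def distrib_right character_add)
qed

text \<open>Double counting of the sum of \<open>\<chi> (b * x)\<close>: summing over
  \<open>x\<close> first leaves \<open>card K\<close> for each annihilating \<open>b\<close>, and
  summing over \<open>b\<close> first leaves only \<open>x = 0\<close>.\<close>

lemma card_annihilator:
  assumes K: "additive_subgroup (K :: 'a set)"
  shows "card {b. \<forall>x\<in>K. \<chi> (b * x) = 1} * card K = card (UNIV :: 'a set)"
proof -
  have "(of_nat (card {b. \<forall>x\<in>K. \<chi> (b * x) = 1} * card K) :: complex) =
      (\<Sum>b\<in>UNIV. if \<forall>x\<in>K. \<chi> (b * x) = 1 then of_nat (card K) else 0)"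
    by (simp add: sum.If_cases)
  also have "\<dots> = (\<Sum>b\<in>UNIV. \<Sum>x\<in>K. \<chi> (b * x))"
    by (intro sum.cong refl sum_character_subgroup[OF K, symmetric])
      (simp add: distrib_left character_add)
  also have "\<dots> = (\<Sum>x\<in>K. \<Sum>b\<in>UNIV. \<chi> (b * x))"
    by (rule sum.swap)
  also have "\<dots> = of_nat (card (UNIV :: 'a set))"
    using additive_subgroupD(1)[OF K] by (simp add: sum_character_mult)
  finally show ?thesis
    by (simp only: of_nat_eq_iff)
qed

text \<open>The sum factors over the coordinates into one-dimensional orthogonality sums.\<close>

lemma sum_character_pairing:
  "(\<Sum>b\<in>coord_vectors m. \<chi> (pairing m b v)) =
    (if \<forall>i\<in>{1..m+1}. v i = 0 then of_nat (card (UNIV :: 'a set)) ^ (m + 1) else 0)"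
proof -
  have "(\<Sum>b\<in>coord_vectors m. \<chi> (pairing m b v)) = (\<Prod>i\<in>{1..m+1}. \<Sum>x\<in>UNIV. \<chi> (x * v i))"
    unfolding coord_vectors_def pairing_def character_sum by (rule prod_sum_PiE[symmetric]) auto
  also have "\<dots> = (if \<forall>i\<in>{1..m+1}. v i = 0 then of_nat (card (UNIV :: 'a set)) ^ (m + 1) else 0)"
  proof (cases "\<forall>i\<in>{1..m+1}. v i = 0")
    case False
    then obtain i where "i \<in> {1..m+1}" "v i \<noteq> 0"
      by blast
    then have "(\<Prod>i\<in>{1..m+1}. \<Sum>x\<in>UNIV. \<chi> (x * v i)) = 0"
      by (intro prod_zero bexI[of _ i]) (auto simp: sum_character_mult)
    then show ?thesis
      by (simp only: False if_False)
  qed simp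
  finally show ?thesis .
qed

text \<open>The sum over \<open>l\<close> kills every \<open>y\<close> outside the kernel
  \<open>K\<close>; what remains is the sum of the character
  \<open>y \<mapsto> \<chi> (b 1 * y)\<close> over the subgroup \<open>K\<close>.\<close>

lemma character_eigenvalue_eq:
  fixes b :: "nat \<Rightarrow> 'a" and m :: nat
  defines "K \<equiv> {x. linearized_poly CHAR('a) m b x = 0}"
  shows "character_eigenvalue \<chi> CHAR('a) m b =
    (if \<forall>x\<in>K. \<chi> (b 1 * x) = 1 then of_nat (card (UNIV :: 'a set) * card K) else 0)"
proof -
  have "character_eigenvalue \<chi> CHAR('a) m b =
      (\<Sum>y\<in>UNIV. \<chi> (b 1 * y) * (\<Sum>l\<in>UNIV. \<chi> (l * linearized_poly CHAR('a) m b y)))"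
    by (simp add: character_eigenvalue_def character_add sum_distrib_left)
  also have "\<dots> = (\<Sum>y\<in>UNIV. if y \<in> K then of_nat (card (UNIV :: 'a set)) * \<chi> (b 1 * y) else 0)"
    by (intro sum.cong refl) (simp add: sum_character_mult K_def)
  also have "\<dots> = of_nat (card (UNIV :: 'a set)) * (\<Sum>y\<in>K. \<chi> (b 1 * y))"
    by (simp add: sum.If_cases sum_distrib_left)
  also have "(\<Sum>y\<in>K. \<chi> (b 1 * y)) = (if \<forall>x\<in>K. \<chi> (b 1 * x) = 1 then of_nat (card K) else 0)"
    unfolding K_def
    by (intro sum_character_subgroup additive_subgroup_kernel additive_linearized_poly)
      (simp add: distrib_left character_add)
  finally show ?thesis
    by simp
qed

context
  fixes e m :: nat
  assumes q: "card (UNIV :: 'a set) = CHAR('a) ^ e" and m: "e \<le> m"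
begin

lemma card_trivial_on_kernel:
  assumes "card {x :: 'a. linearized_poly CHAR('a) m c x = 0} = CHAR('a) ^ i" "i \<le> e"
  shows "card {b. \<forall>x\<in>{x. linearized_poly CHAR('a) m c x = 0}. \<chi> (b * x) = 1} = CHAR('a) ^ (e - i)"
proof -
  have "card {b. \<forall>x\<in>{x. linearized_poly CHAR('a) m c x = 0}. \<chi> (b * x) = 1} * CHAR('a) ^ i =
      CHAR('a) ^ (e - i) * CHAR('a) ^ i"
    using card_annihilator[OF additive_subgroup_kernel[OF additive_linearized_poly[of m c]]] assms q
    by (simp add: power_add[symmetric])
  then show ?thesis
    using prime_gt_0_nat[OF prime_CHAR_finite_field[where 'a='a]] by simp
qed

text \<open>Each tail with a kernel of size \<open>CHAR('a) ^ i\<close> admits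
  \<open>CHAR('a) ^ (e - i)\<close> values of \<open>b 1\<close>, the factor by which
  \<open>n_pow\<close> exceeds \<open>rank_quotient\<close>.\<close>

lemma card_character_eigenvalue_eq:
  assumes i: "i \<le> e"
  shows "real (card {b \<in> coord_vectors m. character_eigenvalue \<chi> CHAR('a) m b =
      of_nat (CHAR('a) ^ e * CHAR('a) ^ i)}) =
    real ((CHAR('a) ^ e) ^ (m - e)) * n_pow CHAR('a) e i"
proof -
  let ?p = "CHAR('a)" and ?C = "{2..m+1} \<rightarrow>\<^sub>E (UNIV :: 'a set)"
  let ?K = "\<lambda>c. {x :: 'a. linearized_poly ?p m c x = 0}"
  have p: "?p > 1"
    using prime_gt_1_nat[OF prime_CHAR_finite_field] .
  have "character_eigenvalue \<chi> ?p m (c(1 := x)) = of_nat (?p ^ e * ?p ^ i) \<longleftrightarrow>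
      card (?K c) = ?p ^ i \<and> (\<forall>y\<in>?K c. \<chi> (x * y) = 1)" for c x
    unfolding character_eigenvalue_eq linearized_poly_upd_1 q
    using p by (auto simp del: of_nat_mult of_nat_power simp: of_nat_eq_iff)
  then have "card {b \<in> coord_vectors m. character_eigenvalue \<chi> ?p m b = of_nat (?p ^ e * ?p ^ i)} =
      (\<Sum>c\<in>?C. card {x. card (?K c) = ?p ^ i \<and> (\<forall>y\<in>?K c. \<chi> (x * y) = 1)})"
    unfolding card_coord_vectors_Collect by simp
  also have "\<dots> = (\<Sum>c\<in>?C. if card (?K c) = ?p ^ i then ?p ^ (e - i) else 0)"
    by (intro sum.cong refl) (use card_trivial_on_kernel[OF _ i] in auto)
  also have "\<dots> = card {c \<in> ?C. card (?K c) = ?p ^ i} * ?p ^ (e - i)"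
    by (simp add: sum.If_cases finite_PiE Int_def)
  finally show ?thesis
    using real_card_linearized_poly_kernel[OF q m i] by (simp add: n_pow_def)
qed

text \<open>The eigenvalue vanishes exactly for those \<open>b 1\<close> that are nontrivial on the
  kernel, which is a complement count for each kernel size.\<close>

lemma card_character_eigenvalue_0:
  "real (card {b \<in> coord_vectors m. character_eigenvalue \<chi> CHAR('a) m b = 0}) =
    real ((CHAR('a) ^ e) ^ (m - e)) * n_zero CHAR('a) e"
proof -
  let ?p = "CHAR('a)" and ?C = "{2..m+1} \<rightarrow>\<^sub>E (UNIV :: 'a set)"
  let ?K = "\<lambda>c. {x :: 'a. linearized_poly ?p m c x = 0}"
  have p: "?p > 1"
    using prime_gt_1_nat[OF prime_CHAR_finite_field] .
  have fin: "finite ?C"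
    by (auto intro: finite_PiE)
  have "card (?K c) \<noteq> 0" for c
  proof -
    obtain i where "card (?K c) = ?p ^ i"
      using card_linearized_poly_kernel_power[OF q] by blast
    then show ?thesis
      using p by (simp only:) simp
  qed
  then have nonzero: "(of_nat (?p ^ e * card (?K c)) :: complex) \<noteq> 0" for c
    using p by (simp only: of_nat_eq_0_iff mult_eq_0_iff power_eq_0_iff) simp
  have if_eq_0: "a \<noteq> 0 \<Longrightarrow> (if P then a else 0) = 0 \<longleftrightarrow> \<not> P" for P and a :: complex
    by simp
  have "character_eigenvalue \<chi> ?p m (c(1 := x)) = 0 \<longleftrightarrow> \<not> (\<forall>y\<in>?K c. \<chi> (x * y) = 1)" for c x
    unfolding character_eigenvalue_eq linearized_poly_upd_1 q fun_upd_same
    by (rule if_eq_0[OF nonzero])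
  then have "real (card {b \<in> coord_vectors m. character_eigenvalue \<chi> ?p m b = 0}) =
      (\<Sum>c\<in>?C. real (card {x. \<not> (\<forall>y\<in>?K c. \<chi> (x * y) = 1)}))"
    unfolding card_coord_vectors_Collect by simp
  \<comment> \<open>Exactly one \<open>i\<close> passes the test for each \<open>c\<close>, so the
    inner sum sorts the tails by kernel size.\<close>
  also have "\<dots> = (\<Sum>c\<in>?C. \<Sum>i\<in>{0..e}. if card (?K c) = ?p ^ i then real ?p ^ e - real ?p ^ (e - i) else 0)"
  proof (intro sum.cong refl)
    fix c
    obtain i where i: "i \<le> e" "card (?K c) = ?p ^ i"
      using card_linearized_poly_kernel_power[OF q] by blast
    let ?T = "{x. \<forall>y\<in>?K c. \<chi> (x * y) = 1}"
    have T: "card ?T = ?p ^ (e - i)"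
      using card_trivial_on_kernel[OF i(2,1)] .
    have "card (- ?T) = ?p ^ e - ?p ^ (e - i)"
      using T q by (simp add: Compl_eq_Diff_UNIV card_Diff_subset)
    moreover have "?p ^ (e - i) \<le> ?p ^ e"
      using p by (intro power_increasing) auto
    ultimately have "real (card (- ?T)) = real ?p ^ e - real ?p ^ (e - i)"
      by (simp add: of_nat_diff)
    moreover have "{x. \<not> (\<forall>y\<in>?K c. \<chi> (x * y) = 1)} = - ?T"
      by auto
    moreover have "card (?K c) = ?p ^ j \<longleftrightarrow> j = i" for j
      using i(2) p by auto
    ultimately show "real (card {x. \<not> (\<forall>y\<in>?K c. \<chi> (x * y) = 1)}) =
        (\<Sum>i\<in>{0..e}. if card (?K c) = ?p ^ i then real ?p ^ e - real ?p ^ (e - i) else 0)"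
      using i(1) by (simp only:) simp
  qed
  also have "\<dots> = (\<Sum>i\<in>{0..e}. \<Sum>c\<in>?C. if card (?K c) = ?p ^ i then real ?p ^ e - real ?p ^ (e - i) else 0)"
    by (rule sum.swap)
  also have "\<dots> = (\<Sum>i\<in>{0..e}. real ((?p ^ e) ^ (m - e)) * ((real ?p ^ e - real ?p ^ (e - i)) * rank_quotient ?p e i))"
  proof (intro sum.cong refl)
    fix i assume "i \<in> {0..e}"
    then have "real (card {c \<in> ?C. card (?K c) = ?p ^ i}) = real ((?p ^ e) ^ (m - e)) * rank_quotient ?p e i"
      by (intro real_card_linearized_poly_kernel q m) simp
    moreover have "(\<Sum>c\<in>?C. if card (?K c) = ?p ^ i then real ?p ^ e - real ?p ^ (e - i) else 0) =
        real (card {c \<in> ?C. card (?K c) = ?p ^ i}) * (real ?p ^ e - real ?p ^ (e - i))"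
      using fin by (simp add: sum.If_cases Int_def)
    ultimately show "(\<Sum>c\<in>?C. if card (?K c) = ?p ^ i then real ?p ^ e - real ?p ^ (e - i) else 0) =
        real ((?p ^ e) ^ (m - e)) * ((real ?p ^ e - real ?p ^ (e - i)) * rank_quotient ?p e i)"
      by (simp only: mult_ac)
  qed
  \<comment> \<open>The term \<open>i = 0\<close> is zero, so the sum may start at 1 as in
    \<open>n_zero\<close>.\<close>
  also have "\<dots> = real ((?p ^ e) ^ (m - e)) * n_zero ?p e"
    by (simp add: n_zero_def sum_distrib_left sum.atLeast_Suc_atMost)
  finally show ?thesis .
qed

end

end

lemma character_eigenvalue_cases:
  fixes \<chi> :: "'a::{field,finite} \<Rightarrow> complex"
  assumes \<chi>: "nontrivial_additive_character \<chi>" and q: "card (UNIV :: 'a set) = CHAR('a) ^ e"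
  shows "character_eigenvalue \<chi> CHAR('a) m b = 0 \<or>
    (\<exists>i\<le>e. character_eigenvalue \<chi> CHAR('a) m b = of_nat (CHAR('a) ^ e * CHAR('a) ^ i))"
  using character_eigenvalue_eq[OF \<chi>, of m b] card_linearized_poly_kernel_power[OF q, of m b]
  unfolding q by (metis (no_types, lifting))

section \<open>The characteristic polynomial\<close>

lemma adjacency_matrix_eq_kernel_mat:
  "adjacency_matrix vs E = kernel_mat vs vs (\<lambda>u v. of_bool ((u, v) \<in> E))"
  unfolding adjacency_matrix_def kernel_mat_def by (rule cong_mat) auto

section \<open>Incident points and lines, parametrized by their first coordinate\<close>

definition point_on_line :: "nat \<Rightarrow> nat \<Rightarrow> (nat \<Rightarrow> 'a::field) \<Rightarrow> 'a \<Rightarrow> nat \<Rightarrow> 'a" where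
  "point_on_line p m v x = (\<lambda>i\<in>{1..m+1}. if i = 1 then x else x ^ (p ^ (i - 2)) * v 1 - v i)"

definition line_through_point :: "nat \<Rightarrow> nat \<Rightarrow> (nat \<Rightarrow> 'a::field) \<Rightarrow> 'a \<Rightarrow> nat \<Rightarrow> 'a" where
  "line_through_point p m v l = (\<lambda>i\<in>{1..m+1}. if i = 1 then l else v 1 ^ (p ^ (i - 2)) * l - v i)"

text \<open>Once the first coordinate is chosen, each incidence equation can be solved for the
  corresponding coordinate of the point.\<close>

lemma points_on_line_eq:
  fixes L :: "nat \<Rightarrow> 'a::field"
  shows "{P \<in> coord_vectors m. wenger_incident p m P L} = range (point_on_line p m L)"
    and "inj (point_on_line p m L)"
proof
  show "range (point_on_line p m L) \<subseteq> {P \<in> coord_vectors m. wenger_incident p m P L}"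
    by (auto simp: point_on_line_def coord_vectors_def wenger_incident_def)
  show "{P \<in> coord_vectors m. wenger_incident p m P L} \<subseteq> range (point_on_line p m L)"
  proof
    fix P assume *: "P \<in> {P \<in> coord_vectors m. wenger_incident p m P L}"
    have "P = point_on_line p m L (P 1)"
    proof (rule PiE_ext[of _ "{1..m+1}" "\<lambda>_. UNIV"])
      fix i assume "i \<in> {1..m+1}"
      then consider "i = 1" | "i \<in> {2..m+1}"
        by fastforce
      then show "P i = point_on_line p m L (P 1) i"
        using * by cases (auto simp: point_on_line_def wenger_incident_def algebra_simps)
    qed (use * in \<open>auto simp: point_on_line_def coord_vectors_def\<close>)
    then show "P \<in> range (point_on_line p m L)"
      by blast
  qed
  show "inj (point_on_line p m L)"
  proof (rule injI)
    fix x y assume "point_on_line p m L x = point_on_line p m L y"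
    from fun_cong[OF this, of 1] show "x = y"
      by (simp add: point_on_line_def)
  qed
qed

lemma lines_through_point_eq:
  fixes P :: "nat \<Rightarrow> 'a::field"
  shows "{L \<in> coord_vectors m. wenger_incident p m P L} = range (line_through_point p m P)"
    and "inj (line_through_point p m P)"
proof
  show "range (line_through_point p m P) \<subseteq> {L \<in> coord_vectors m. wenger_incident p m P L}"
    by (auto simp: line_through_point_def coord_vectors_def wenger_incident_def)
  show "{L \<in> coord_vectors m. wenger_incident p m P L} \<subseteq> range (line_through_point p m P)"
  proof
    fix L assume *: "L \<in> {L \<in> coord_vectors m. wenger_incident p m P L}"
    have "L = line_through_point p m P (L 1)"
    proof (rule PiE_ext[of _ "{1..m+1}" "\<lambda>_. UNIV"])
      fix i assume "i \<in> {1..m+1}"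
      then consider "i = 1" | "i \<in> {2..m+1}"
        by fastforce
      then show "L i = line_through_point p m P (L 1) i"
        using * by cases (auto simp: line_through_point_def wenger_incident_def algebra_simps)
    qed (use * in \<open>auto simp: line_through_point_def coord_vectors_def\<close>)
    then show "L \<in> range (line_through_point p m P)"
      by blast
  qed
  show "inj (line_through_point p m P)"
  proof (rule injI)
    fix x y assume "line_through_point p m P x = line_through_point p m P y"
    from fun_cong[OF this, of 1] show "x = y"
      by (simp add: line_through_point_def)
  qed
qed

lemma wenger_adj_simps [simp]:
  "(Inl P, Inr L) \<in> wenger_adj p m \<longleftrightarrow>
    P \<in> coord_vectors m \<and> L \<in> coord_vectors m \<and> wenger_incident p m P L"
  "(Inr L, Inl P) \<in> wenger_adj p m \<longleftrightarrow>
    P \<in> coord_vectors m \<and> L \<in> coord_vectors m \<and> wenger_incident p m P L"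
  "(Inl P, Inl P') \<notin> wenger_adj p m" "(Inr L, Inr L') \<notin> wenger_adj p m"
  by (auto simp: wenger_adj_def Let_def)

lemma finite_coord_vectors [simp]: "finite (coord_vectors m :: (nat \<Rightarrow> 'a::finite) set)"
  unfolding coord_vectors_def by (auto intro: finite_PiE)

lemma card_coord_vectors: "card (coord_vectors m :: (nat \<Rightarrow> 'a) set) = card (UNIV :: 'a set) ^ (m + 1)"
  by (simp add: coord_vectors_def card_funcsetE)

lemma sum_points_on_line:
  fixes g :: "(nat \<Rightarrow> 'a::{field,finite}) \<Rightarrow> complex"
  shows "(\<Sum>P\<in>coord_vectors m. of_bool (wenger_incident p m P L) * g P) = (\<Sum>x\<in>UNIV. g (point_on_line p m L x))"
proof -
  have "(\<Sum>P\<in>coord_vectors m. of_bool (wenger_incident p m P L) * g P) =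
      (\<Sum>P\<in>{P \<in> coord_vectors m. wenger_incident p m P L}. g P)"
    by (rule sum.mono_neutral_cong_right) auto
  then show ?thesis
    unfolding points_on_line_eq by (simp add: sum.reindex[OF points_on_line_eq(2)])
qed

lemma sum_lines_through_point:
  fixes g :: "(nat \<Rightarrow> 'a::{field,finite}) \<Rightarrow> complex"
  shows "(\<Sum>L\<in>coord_vectors m. of_bool (wenger_incident p m P L) * g L) = (\<Sum>l\<in>UNIV. g (line_through_point p m P l))"
proof -
  have "(\<Sum>L\<in>coord_vectors m. of_bool (wenger_incident p m P L) * g L) =
      (\<Sum>L\<in>{L \<in> coord_vectors m. wenger_incident p m P L}. g L)"
    by (rule sum.mono_neutral_cong_right) auto
  then show ?thesis
    unfolding lines_through_point_eq by (simp add: sum.reindex[OF lines_through_point_eq(2)])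
qed

section \<open>Two-step walks and the diagonalisation of \<open>N N^T\<close>\<close>

lemma pairing_eq: "pairing m b v = b 1 * v 1 + (\<Sum>k\<in>{2..m+1}. b k * v k)"
proof -
  have "{1..m+1} = insert 1 {2..m+1}"
    by auto
  then show ?thesis
    by (simp add: pairing_def)
qed

text \<open>The walk adds \<open>l * ((P 1 + y) ^ (p ^ (k - 2)) - P 1 ^ (p ^ (k - 2)))\<close> to
  coordinate \<open>k\<close>; by additivity of the linearized polynomial the total change of the
  pairing does not depend on \<open>P\<close>.\<close>

lemma pairing_two_steps:
  fixes b P :: "nat \<Rightarrow> 'a::{field,finite}" and l y :: 'a
  defines "p \<equiv> CHAR('a)"
  shows "pairing m b (point_on_line p m (line_through_point p m P l) (P 1 + y)) =
    pairing m b P + (b 1 * y + l * linearized_poly p m b y)"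
proof -
  interpret additive "linearized_poly p m b"
    unfolding p_def by (rule additive_linearized_poly)
  have "(\<Sum>k\<in>{2..m+1}. b k * point_on_line p m (line_through_point p m P l) (P 1 + y) k) =
      (\<Sum>k\<in>{2..m+1}. l * (b k * (P 1 + y) ^ (p ^ (k - 2))) - l * (b k * P 1 ^ (p ^ (k - 2))) + b k * P k)"
    by (rule sum.cong) (auto simp: point_on_line_def line_through_point_def algebra_simps)
  also have "\<dots> = l * linearized_poly p m b (P 1 + y) - l * linearized_poly p m b (P 1)
      + (\<Sum>k\<in>{2..m+1}. b k * P k)"
    unfolding linearized_poly_def by (simp only: sum.distrib sum_subtractf sum_distrib_left)
  also have "\<dots> = l * linearized_poly p m b y + (\<Sum>k\<in>{2..m+1}. b k * P k)"
    by (simp add: add distrib_left)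
  finally show ?thesis
    unfolding pairing_eq by (simp add: point_on_line_def algebra_simps)
qed

text \<open>The entries of \<open>N N^T\<close>: the number of lines through both points.\<close>

definition collinearity_kernel :: "nat \<Rightarrow> nat \<Rightarrow> (nat \<Rightarrow> 'a::field) \<Rightarrow> (nat \<Rightarrow> 'a) \<Rightarrow> complex" where
  "collinearity_kernel p m P P' =
     (\<Sum>L\<in>coord_vectors m. of_bool (wenger_incident p m P L) * of_bool (wenger_incident p m P' L))"

lemma collinearity_kernel_character:
  fixes \<chi> :: "'a::{field,finite} \<Rightarrow> complex"
  assumes \<chi>: "nontrivial_additive_character \<chi>"
  defines "p \<equiv> CHAR('a)"
  shows "(\<Sum>P'\<in>coord_vectors m. collinearity_kernel p m P P' * \<chi> (pairing m b P')) =
    \<chi> (pairing m b P) * character_eigenvalue \<chi> p m b"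
proof -
  have "(\<Sum>P'\<in>coord_vectors m. collinearity_kernel p m P P' * \<chi> (pairing m b P')) =
      (\<Sum>P'\<in>coord_vectors m. \<Sum>L\<in>coord_vectors m. of_bool (wenger_incident p m P L) *
        (of_bool (wenger_incident p m P' L) * \<chi> (pairing m b P')))"
    by (simp add: collinearity_kernel_def sum_distrib_right mult.assoc)
  also have "\<dots> = (\<Sum>L\<in>coord_vectors m. of_bool (wenger_incident p m P L) *
      (\<Sum>P'\<in>coord_vectors m. of_bool (wenger_incident p m P' L) * \<chi> (pairing m b P')))"
    unfolding sum_distrib_left by (rule sum.swap)
  also have "\<dots> = (\<Sum>l\<in>UNIV. \<Sum>x\<in>UNIV. \<chi> (pairing m b (point_on_line p m (line_through_point p m P l) x)))"
    unfolding sum_points_on_line sum_lines_through_point ..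
  \<comment> \<open>Measuring the first coordinate of the end point relative to \<open>P 1\<close>
    makes the walk a translation.\<close>
  also have "\<dots> = (\<Sum>l\<in>UNIV. \<Sum>y\<in>UNIV. \<chi> (pairing m b (point_on_line p m (line_through_point p m P l) (P 1 + y))))"
  proof (rule sum.cong[OF refl])
    fix l
    have "bij (\<lambda>y. P 1 + y)"
      by (rule bij_betwI[of _ _ _ "\<lambda>x. x - P 1"]) auto
    then show "(\<Sum>x\<in>UNIV. \<chi> (pairing m b (point_on_line p m (line_through_point p m P l) x))) =
        (\<Sum>y\<in>UNIV. \<chi> (pairing m b (point_on_line p m (line_through_point p m P l) (P 1 + y))))"
      by (rule sum.reindex_bij_betw[symmetric])
  qed
  also have "\<dots> = (\<Sum>l\<in>UNIV. \<Sum>y\<in>UNIV. \<chi> (pairing m b P) * \<chi> (b 1 * y + l * linearized_poly p m b y))"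
    unfolding p_def pairing_two_steps character_add[OF \<chi>, of "pairing m b P"] ..
  also have "\<dots> = (\<Sum>y\<in>UNIV. \<Sum>l\<in>UNIV. \<chi> (pairing m b P) * \<chi> (b 1 * y + l * linearized_poly p m b y))"
    by (rule sum.swap)
  finally show ?thesis
    by (simp add: character_eigenvalue_def sum_distrib_left)
qed

text \<open>Supplies the inverse of the character table. Vectors are extensional, so agreement on
  the index set is equality.\<close>

lemma sum_character_pairing_diff:
  fixes \<chi> :: "'a::{field,finite} \<Rightarrow> complex"
  assumes \<chi>: "nontrivial_additive_character \<chi>" and "v \<in> coord_vectors m" "w \<in> coord_vectors m"
  shows "(\<Sum>b\<in>coord_vectors m. \<chi> (pairing m b v) * \<chi> (- pairing m b w)) =
    of_bool (v = w) * of_nat (card (UNIV :: 'a set)) ^ (m + 1)"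
proof -
  have "\<chi> (pairing m b v) * \<chi> (- pairing m b w) = \<chi> (pairing m b (\<lambda>i. v i - w i))" for b
    by (simp only: character_add[OF \<chi>, symmetric] pairing_def right_diff_distrib sum_subtractf
        add_uminus_conv_diff)
  moreover have "(\<forall>i\<in>{1..m+1}. v i - w i = 0) \<longleftrightarrow> v = w"
    using assms(2,3) unfolding coord_vectors_def by (auto intro: PiE_ext)
  ultimately show ?thesis
    using sum_character_pairing[OF \<chi>, of m "\<lambda>i. v i - w i"] by simp
qed

lemma wenger_char_poly:
  fixes vs :: "((nat \<Rightarrow> 'a::{field,finite}) + (nat \<Rightarrow> 'a)) list"
  assumes \<chi>: "nontrivial_additive_character (\<chi> :: 'a \<Rightarrow> complex)"
    and vs: "distinct vs" "set vs = wenger_verts m"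
  shows "char_poly (adjacency_matrix vs (wenger_adj CHAR('a) m)) =
    (\<Prod>b\<in>coord_vectors m. [:- character_eigenvalue \<chi> CHAR('a) m b, 0, 1:])"
proof -
  let ?p = "CHAR('a)" and ?Q = "of_nat (card (UNIV :: 'a set)) ^ (m + 1) :: complex"
  obtain ps :: "(nat \<Rightarrow> 'a) list" where ps: "distinct ps" "set ps = coord_vectors m"
    using finite_distinct_list[OF finite_coord_vectors] by blast
  \<comment> \<open>Points and lines range over the same set of vectors, so one list serves both
    sides, and also as the list of character indices.\<close>
  let ?ws = "map Inl ps @ map Inr ps" and ?n = "length ps"
  let ?K = "\<lambda>u v. of_bool ((u, v) \<in> wenger_adj ?p m) :: complex"
  let ?N = "kernel_mat ps ps (\<lambda>P L. of_bool (wenger_incident ?p m P L) :: complex)"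
  let ?M = "kernel_mat ps ps (\<lambda>L P. of_bool (wenger_incident ?p m P L) :: complex)"
  have ws: "distinct ?ws" "set ?ws = wenger_verts m"
    using ps by (auto simp: wenger_verts_def Plus_def distinct_map inj_on_def)
  have Q: "?Q \<noteq> 0"
    by (simp add: card_eq_0_iff)
  have 0: "kernel_mat ps ps (\<lambda>x y. of_bool False) = (0\<^sub>m ?n ?n :: complex mat)"
    by (rule eq_matI) (auto simp: kernel_mat_def)
  have "char_poly (adjacency_matrix vs (wenger_adj ?p m)) = char_poly (kernel_mat ?ws ?ws ?K)"
    unfolding adjacency_matrix_eq_kernel_mat using vs ws
    by (intro char_poly_kernel_mat_reorder) auto
  also have "kernel_mat ?ws ?ws ?K = four_block_mat (0\<^sub>m ?n ?n) ?N ?M (0\<^sub>m ?n ?n)"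
    unfolding kernel_mat_sum_type 0[symmetric]
    by (intro cong_four_block_mat kernel_mat_cong) (use ps in auto)
  finally have "poly (char_poly (adjacency_matrix vs (wenger_adj ?p m))) k =
      poly (char_poly (?N * ?M)) (k\<^sup>2)" for k
    by (simp only:) (rule poly_char_poly_bipartite; simp)
  moreover have "?N * ?M = kernel_mat ps ps (collinearity_kernel ?p m)"
    unfolding kernel_mat_mult[OF ps(1)] collinearity_kernel_def ps(2) ..
  moreover have "char_poly (kernel_mat ps ps (collinearity_kernel ?p m)) =
      (\<Prod>b\<in>set ps. [:- character_eigenvalue \<chi> ?p m b, 1:])"
  proof (rule char_poly_kernel_mat_diagonal[where F = "\<lambda>P b. \<chi> (pairing m b P)"
        and G = "\<lambda>b P. \<chi> (- pairing m b P) / ?Q"])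
    fix v w assume "v \<in> set ps" "w \<in> set ps"
    then show "(\<Sum>b\<in>set ps. \<chi> (pairing m b v) * (\<chi> (- pairing m b w) / ?Q)) = of_bool (v = w)"
      using sum_character_pairing_diff[OF \<chi>, of v m w] Q
      by (simp only: ps(2) times_divide_eq_right sum_divide_distrib[symmetric]) simp
  next
    fix v b assume "v \<in> set ps" "b \<in> set ps"
    show "(\<Sum>w\<in>set ps. collinearity_kernel ?p m v w * \<chi> (pairing m b w)) =
        \<chi> (pairing m b v) * character_eigenvalue \<chi> ?p m b"
      unfolding ps(2) by (rule collinearity_kernel_character[OF \<chi>])
  qed (use ps in auto)
  \<comment> \<open>Over the infinite field of complex numbers it is enough to compare values at
    every \<open>k\<close>.\<close>
  ultimately have "poly (char_poly (adjacency_matrix vs (wenger_adj ?p m))) k =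
      poly (\<Prod>b\<in>coord_vectors m. [:- character_eigenvalue \<chi> ?p m b, 0, 1:]) k" for k
    by (simp add: ps(2) poly_prod power2_eq_square)
  then show ?thesis
    by (intro poly_eq_poly_eq_iff[THEN iffD1] ext)
qed

section \<open>Connected components\<close>

text \<open>If \<open>\<chi>(\<langle>b, -\<rangle>)\<close> is trivial on the two-step translations then it is constant on the points of
  a component; otherwise its sum over these points is fixed by multiplication with a number
  other than 1.\<close>

lemma card_reachable_points:
  fixes \<chi> :: "'a::{field,finite} \<Rightarrow> complex" and P\<^sub>0 :: "nat \<Rightarrow> 'a"
  assumes \<chi>: "nontrivial_additive_character \<chi>" and P\<^sub>0: "P\<^sub>0 \<in> coord_vectors m"
  defines "p \<equiv> CHAR('a)" and "q \<equiv> card (UNIV :: 'a set)"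
  defines "S \<equiv> {P \<in> coord_vectors m. (Inl P\<^sub>0, Inl P) \<in> (wenger_adj p m)\<^sup>*}"
  shows "card S * card {b \<in> coord_vectors m. character_eigenvalue \<chi> p m b = of_nat (q * q)} = q ^ (m + 1)"
proof -
  let ?T = "{b \<in> coord_vectors m. character_eigenvalue \<chi> p m b = of_nat (q * q)}"
  have q: "q > 0"
    by (simp add: q_def card_gt_0_iff)
  have fin: "finite S"
    unfolding S_def by simp
  have inner: "(\<Sum>P\<in>S. \<chi> (pairing m b P) * \<chi> (- pairing m b P\<^sub>0)) =
      (if b \<in> ?T then of_nat (card S) else 0)" if b: "b \<in> coord_vectors m" for b
  proof (cases "b \<in> ?T")
    case True
    let ?K = "{x. linearized_poly p m b x = 0}"
    \<comment> \<open>The eigenvalue \<open>q * q\<close> forces the kernel to be the whole field,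
      so the linearized polynomial vanishes identically and \<open>b 1\<close> gives the trivial
      character.\<close>
    have trivial: "\<forall>x\<in>?K. \<chi> (b 1 * x) = 1" and "of_nat (q * card ?K) = (of_nat (q * q) :: complex)"
      using True q character_eigenvalue_eq[OF \<chi>, of m b, folded p_def q_def]
      by (auto split: if_splits)
    then have "card ?K = card (UNIV :: 'a set)"
      using q unfolding of_nat_eq_iff q_def[symmetric] by simp
    then have "?K = UNIV"
      by (intro card_subset_eq) auto
    then have K: "linearized_poly p m b x = 0" "\<chi> (b 1 * x) = 1" for x
      using trivial by auto
    \<comment> \<open>Extends the character from points to lines so that it is constant along edges:
      on an incident pair the coordinates from 2 on pair to
      \<open>L 1 * linearized_poly p m b (P 1) = 0\<close>.\<close>
    define h where "h = case_sum (\<lambda>P. \<chi> (pairing m b P)) (\<lambda>L. \<chi> (- (\<Sum>k\<in>{2..m+1}. b k * L k)))"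
    have edge: "h (Inl P) = h (Inr L)" if "wenger_incident p m P L" for P L
    proof -
      have "(\<Sum>k\<in>{2..m+1}. b k * P k) + (\<Sum>k\<in>{2..m+1}. b k * L k) =
          (\<Sum>k\<in>{2..m+1}. L 1 * (b k * P 1 ^ (p ^ (k - 2))))"
        unfolding sum.distrib[symmetric]
      proof (rule sum.cong)
        fix k assume "k \<in> {2..m+1}"
        then have "L k + P k = P 1 ^ (p ^ (k - 2)) * L 1"
          using that by (simp add: wenger_incident_def)
        moreover have "b k * P k + b k * L k = b k * (L k + P k)"
          by (simp add: distrib_left)
        ultimately show "b k * P k + b k * L k = L 1 * (b k * P 1 ^ (p ^ (k - 2)))"
          by (simp only: mult_ac)
      qed simp
      also have "\<dots> = L 1 * linearized_poly p m b (P 1)"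
        by (simp only: linearized_poly_def sum_distrib_left)
      finally have "(\<Sum>k\<in>{2..m+1}. b k * P k) = - (\<Sum>k\<in>{2..m+1}. b k * L k)"
        unfolding K(1) by (simp only: mult_zero_right eq_neg_iff_add_eq_0)
      then show ?thesis
        unfolding h_def sum.case pairing_eq character_add[OF \<chi>] K(2) by simp
    qed
    have step: "h u = h v" if "(u, v) \<in> wenger_adj p m" for u v
      using that edge by (cases u; cases v) auto
    have "h u = h v" if "(u, v) \<in> (wenger_adj p m)\<^sup>*" for u v
      using that by (induction rule: rtrancl_induct) (auto dest: step)
    then have "\<chi> (pairing m b P) = \<chi> (pairing m b P\<^sub>0)" if "P \<in> S" for P
      using that unfolding S_def h_def by fastforce
    then have "\<chi> (pairing m b P) * \<chi> (- pairing m b P\<^sub>0) = 1" if "P \<in> S" for P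
      using that character_minus_mult[OF \<chi>, of "pairing m b P\<^sub>0"] by (simp add: mult.commute)
    then show ?thesis
      using True by simp
  next
    case False
    \<comment> \<open>If every summand were 1, the eigenvalue would be \<open>q * q\<close>.\<close>
    have "\<exists>y l. \<chi> (b 1 * y + l * linearized_poly p m b y) \<noteq> 1"
    proof (rule ccontr)
      assume "\<not> ?thesis"
      then have "character_eigenvalue \<chi> p m b = of_nat (q * q)"
        by (simp add: character_eigenvalue_def q_def)
      then show False
        using False b by simp
    qed
    then obtain y l where yl: "\<chi> (b 1 * y + l * linearized_poly p m b y) \<noteq> 1"
      by blast
    \<comment> \<open>A two-step walk with fixed \<open>l\<close> and \<open>y\<close>: it permutes
      \<open>S\<close> and multiplies the character by a constant other than 1.\<close>
    define \<tau> where "\<tau> P = point_on_line p m (line_through_point p m P l) (P 1 + y)" for P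
    have "\<tau> P \<in> S" if "P \<in> S" for P
    proof -
      let ?L = "line_through_point p m P l"
      have "?L \<in> coord_vectors m" "wenger_incident p m P ?L"
        using lines_through_point_eq(1)[of m p P] by blast+
      moreover have "\<tau> P \<in> coord_vectors m" "wenger_incident p m (\<tau> P) ?L"
        using points_on_line_eq(1)[of m p ?L] unfolding \<tau>_def by blast+
      ultimately have edges: "(Inl P, Inr ?L) \<in> wenger_adj p m" "(Inr ?L, Inl (\<tau> P)) \<in> wenger_adj p m"
        using that by (auto simp: S_def)
      have "(Inl P\<^sub>0, Inl P) \<in> (wenger_adj p m)\<^sup>*"
        using that by (simp add: S_def)
      then have "(Inl P\<^sub>0, Inl (\<tau> P)) \<in> (wenger_adj p m)\<^sup>*"
        using edges by (blast intro: rtrancl_into_rtrancl)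
      then show ?thesis
        using \<open>\<tau> P \<in> coord_vectors m\<close> by (simp add: S_def)
    qed
    moreover have inj: "inj_on \<tau> S"
    proof (rule inj_onI)
      fix P P' assume *: "P \<in> S" "P' \<in> S" "\<tau> P = \<tau> P'"
      have 1: "P 1 = P' 1"
        using fun_cong[OF *(3), of 1] by (simp add: \<tau>_def point_on_line_def)
      show "P = P'"
      proof (rule PiE_ext[of _ "{1..m+1}" "\<lambda>_. UNIV"])
        fix i assume "i \<in> {1..m+1}"
        then show "P i = P' i"
          using fun_cong[OF *(3), of i] 1
          by (cases "i = 1") (auto simp: \<tau>_def point_on_line_def line_through_point_def)
      qed (use * in \<open>auto simp: S_def coord_vectors_def\<close>)
    qed
    ultimately have "bij_betw \<tau> S S"
      unfolding bij_betw_def using endo_inj_surj[OF fin _ inj] by blast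
    then have "(\<Sum>P\<in>S. \<chi> (pairing m b P)) = (\<Sum>P\<in>S. \<chi> (pairing m b (\<tau> P)))"
      by (rule sum.reindex_bij_betw[symmetric])
    also have "\<dots> = (\<Sum>P\<in>S. \<chi> (pairing m b P)) * \<chi> (b 1 * y + l * linearized_poly p m b y)"
      unfolding \<tau>_def p_def pairing_two_steps character_add[OF \<chi>, of "pairing m b P" for P]
      by (rule sum_distrib_right[symmetric])
    finally have "(\<Sum>P\<in>S. \<chi> (pairing m b P)) = 0"
      using yl by simp
    then show ?thesis
      using False by (simp only: sum_distrib_right[symmetric] mult_zero_left if_False)
  qed
  \<comment> \<open>Double counting: summing over \<open>P\<close> first gives \<open>card S\<close>
    for each \<open>b\<close> in \<open>?T\<close>, and summing over \<open>b\<close> first leaves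
    only \<open>P = P\<^sub>0\<close>.\<close>
  have "(of_nat (card S * card ?T) :: complex) = (\<Sum>b\<in>coord_vectors m. if b \<in> ?T then of_nat (card S) else 0)"
    by (simp add: sum.If_cases Int_def mult.commute)
  also have "\<dots> = (\<Sum>b\<in>coord_vectors m. \<Sum>P\<in>S. \<chi> (pairing m b P) * \<chi> (- pairing m b P\<^sub>0))"
    by (intro sum.cong refl inner[symmetric])
  also have "\<dots> = (\<Sum>P\<in>S. \<Sum>b\<in>coord_vectors m. \<chi> (pairing m b P) * \<chi> (- pairing m b P\<^sub>0))"
    by (rule sum.swap)
  also have "\<dots> = (\<Sum>P\<in>S. if P = P\<^sub>0 then of_nat (q ^ (m + 1)) else 0)"
    by (intro sum.cong refl, subst sum_character_pairing_diff[OF \<chi>]) (use P\<^sub>0 in \<open>auto simp: S_def q_def\<close>)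
  also have "\<dots> = of_nat (q ^ (m + 1))"
    using P\<^sub>0 fin by (simp add: S_def)
  finally show ?thesis
    by (simp only: of_nat_eq_iff)
qed

text \<open>By \<open>card_reachable_points\<close> all components contain equally many points, and
  together they exhaust the \<open>q ^ (m + 1)\<close> points.\<close>

lemma card_components_wenger:
  fixes \<chi> :: "'a::{field,finite} \<Rightarrow> complex"
  assumes \<chi>: "nontrivial_additive_character \<chi>"
  defines "p \<equiv> CHAR('a)" and "q \<equiv> card (UNIV :: 'a set)"
  shows "card (connected_components_of_graph (wenger_verts m)
      (wenger_adj p m :: (((nat \<Rightarrow> 'a) + (nat \<Rightarrow> 'a)) \<times> _) set)) =
    card {b \<in> coord_vectors m. character_eigenvalue \<chi> p m b = of_nat (q * q)}"
    (is "card ?Q = ?T")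
proof -
  let ?V = "wenger_verts m :: ((nat \<Rightarrow> 'a) + (nat \<Rightarrow> 'a)) set"
  let ?E = "wenger_adj p m :: (((nat \<Rightarrow> 'a) + (nat \<Rightarrow> 'a)) \<times> ((nat \<Rightarrow> 'a) + (nat \<Rightarrow> 'a))) set"
  let ?R = "{(u, v) \<in> ?V \<times> ?V. (u, v) \<in> ?E\<^sup>*}"
  let ?C = "coord_vectors m :: (nat \<Rightarrow> 'a) set"
  have Q: "?Q = ?V // ?R"
    by (simp add: connected_components_of_graph_def)
  have "sym ?E"
    by (auto simp: wenger_adj_def Let_def sym_def)
  then have "sym (?E\<^sup>*)"
    by (rule sym_rtrancl)
  then have "sym ?R"
    unfolding sym_def by blast
  moreover have "trans ?R"
    using trans_rtrancl[of ?E] unfolding trans_def by blast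
  moreover have "refl_on ?V ?R"
    by (auto intro!: refl_onI)
  ultimately have equiv: "equiv ?V ?R"
    unfolding equiv_def by blast
  have fin: "finite ?V"
    by (simp add: wenger_verts_def)
  have size: "card (X \<inter> Inl ` ?C) * ?T = q ^ (m + 1)" if X: "X \<in> ?V // ?R" for X
  proof -
    obtain v where v: "v \<in> ?V" "X = ?R `` {v}"
      using X by (rule quotientE)
    \<comment> \<open>A component given by a line also contains a point, for instance the point on
      that line with first coordinate 0.\<close>
    have "\<exists>P. P \<in> ?C \<and> X = ?R `` {Inl P}"
    proof (cases v)
      case (Inl P)
      then show ?thesis
        using v by (auto simp: wenger_verts_def)
    next
      case (Inr L)
      let ?P = "point_on_line p m L 0"
      have P: "?P \<in> ?C" "wenger_incident p m ?P L"
        using points_on_line_eq(1)[of m p L] by blast+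
      moreover have "L \<in> ?C"
        using v Inr by (auto simp: wenger_verts_def)
      ultimately have "(v, Inl ?P) \<in> ?E"
        using Inr by simp
      then have "(v, Inl ?P) \<in> ?R"
        using v P by (auto simp: wenger_verts_def)
      then show ?thesis
        using P v equiv_class_eq[OF equiv] by blast
    qed
    then obtain P where P: "P \<in> ?C" "X = ?R `` {Inl P}"
      by blast
    have "X \<inter> Inl ` ?C = Inl ` {P' \<in> ?C. (Inl P, Inl P') \<in> ?E\<^sup>*}"
      using P by (auto simp: wenger_verts_def)
    then show ?thesis
      using card_reachable_points[OF \<chi> P(1)] by (simp add: card_image p_def q_def)
  qed
  have "q ^ (m + 1) = card (Inl ` ?C :: ((nat \<Rightarrow> 'a) + (nat \<Rightarrow> 'a)) set)"
    by (simp add: card_image card_coord_vectors q_def)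
  also have "Inl ` ?C = (\<Union>X\<in>?V // ?R. X \<inter> Inl ` ?C)"
    using Union_quotient[OF equiv] by (auto simp: wenger_verts_def)
  also have "card \<dots> = (\<Sum>X\<in>?V // ?R. card (X \<inter> Inl ` ?C))"
  proof (rule card_UN_disjoint)
    show "finite (?V // ?R)"
      using fin by (rule finite_quotient) auto
    show "\<forall>X\<in>?V // ?R. \<forall>Y\<in>?V // ?R. X \<noteq> Y \<longrightarrow> (X \<inter> Inl ` ?C) \<inter> (Y \<inter> Inl ` ?C) = {}"
      using quotient_disj[OF equiv] by blast
  qed auto
  \<comment> \<open>Multiplying by \<open>?T\<close> makes every component contribute
    \<open>q ^ (m + 1)\<close> and avoids division.\<close>
  finally have "q ^ (m + 1) * ?T = (\<Sum>X\<in>?V // ?R. card (X \<inter> Inl ` ?C) * ?T)"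
    by (simp only: sum_distrib_right)
  also have "\<dots> = card ?Q * q ^ (m + 1)"
    using size unfolding Q by simp
  finally show ?thesis
    by (simp add: q_def)
qed

section \<open>The spectrum\<close>

lemma rank_quotient_pos: "1 < p \<Longrightarrow> i \<le> e \<Longrightarrow> 0 < rank_quotient p e i"
  unfolding rank_quotient_def by (intro divide_pos_pos prod_pos) auto

lemma n_pow_pos: "1 < p \<Longrightarrow> i \<le> e \<Longrightarrow> 0 < n_pow p e i"
  by (simp add: n_pow_def rank_quotient_pos)

text \<open>The term \<open>i = e\<close> is positive because \<open>e \<ge> 1\<close>, and the
  others are nonnegative.\<close>

lemma n_zero_pos:
  assumes "1 < p" "1 \<le> e"
  shows "0 < n_zero p e"
  unfolding n_zero_def
  by (intro sum_pos2[of _ e] mult_pos_pos mult_nonneg_nonneg)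
    (use assms in \<open>auto intro!: less_imp_le rank_quotient_pos power_increasing\<close>)

theorem theorem3p2:
  fixes p e m q :: nat
    and vs :: "((nat \<Rightarrow> 'a::{field,finite}) + (nat \<Rightarrow> 'a)) list"
    and A :: "complex mat"
  assumes "prime p" and "e \<ge> 1" and "q = p ^ e" and "m \<ge> e"
    and "card (UNIV :: 'a set) = q"
    and "distinct vs" and "set vs = wenger_verts m"
    and "A = adjacency_matrix vs (wenger_adj p m)"
  shows "card (connected_components_of_graph (wenger_verts m)
                 (wenger_adj p m :: (((nat \<Rightarrow> 'a) + (nat \<Rightarrow> 'a)) \<times> ((nat \<Rightarrow> 'a) + (nat \<Rightarrow> 'a))) set))
           = q ^ (m - e)
       \<and> spectrum A = {0} \<union> (\<Union>i\<in>{0..e}. {complex_of_real (sqrt (real (q * p ^ i))),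
                                          - complex_of_real (sqrt (real (q * p ^ i)))})
       \<and> (\<forall>i\<in>{0..e}.
            real (eigenvalue_multiplicity A (complex_of_real (sqrt (real (q * p ^ i)))))
              = real (q ^ (m - e)) * n_pow p e i \<and>
            real (eigenvalue_multiplicity A (- complex_of_real (sqrt (real (q * p ^ i)))))
              = real (q ^ (m - e)) * n_pow p e i)
       \<and> real (eigenvalue_multiplicity A 0) = 2 * (real (q ^ (m - e)) * n_zero p e)"
proof -
  have p: "p > 1"
    using assms(1) by (rule prime_gt_1_nat)
  \<comment> \<open>The characteristic is identified from the cardinality: \<open>p\<close> divides
    a power of the prime \<open>CHAR('a)\<close>.\<close>
  obtain r where r: "p ^ e = CHAR('a) ^ r"
    using card_finite_field[where 'a='a] assms(3,5) by auto
  have "p dvd CHAR('a) ^ r"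
    unfolding r[symmetric] using \<open>e \<ge> 1\<close> by simp
  then have "p dvd CHAR('a)"
    using assms(1) prime_dvd_power by blast
  then have char: "p = CHAR('a)"
    using primes_dvd_imp_eq[OF assms(1) prime_CHAR_finite_field] by blast
  have card: "card (UNIV :: 'a set) = CHAR('a) ^ e"
    using assms(3,5) char by simp
  have q: "q > 0"
    using assms(3) p by simp
  obtain \<chi> :: "'a \<Rightarrow> complex" where \<chi>: "nontrivial_additive_character \<chi>"
    using ex_nontrivial_additive_character by blast
  let ?C = "coord_vectors m :: (nat \<Rightarrow> 'a) set" and ?ev = "character_eigenvalue \<chi> p m"
  let ?s = "\<lambda>i. complex_of_real (sqrt (real (q * p ^ i)))"
  have cp: "char_poly A = (\<Prod>b\<in>?C. [:- ?ev b, 0, 1:])"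
    unfolding assms(8) char using wenger_char_poly[OF \<chi>] assms(6,7) .
  have mult: "eigenvalue_multiplicity A z = card {b \<in> ?C. ?ev b = z\<^sup>2} * (if z = 0 then 2 else 1)" for z
    unfolding eigenvalue_multiplicity_def cp by (rule order_prod_square_minus) simp
  have count: "real (card {b \<in> ?C. ?ev b = of_nat (q * p ^ i)}) = real (q ^ (m - e)) * n_pow p e i"
    if "i \<le> e" for i
    using card_character_eigenvalue_eq[OF \<chi> card assms(4) that] unfolding assms(3) char .
  have count0: "real (card {b \<in> ?C. ?ev b = 0}) = real (q ^ (m - e)) * n_zero p e"
    using card_character_eigenvalue_0[OF \<chi> card assms(4)] unfolding assms(3) char .
  have sq: "(?s i)\<^sup>2 = of_nat (q * p ^ i)" for i
    by (simp only: of_real_power[symmetric] real_sqrt_pow2 of_nat_0_le_iff of_real_of_nat_eq)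
  have nz: "?s i \<noteq> 0" for i
    using q p by simp
  have "card (connected_components_of_graph (wenger_verts m)
      (wenger_adj p m :: (((nat \<Rightarrow> 'a) + (nat \<Rightarrow> 'a)) \<times> ((nat \<Rightarrow> 'a) + (nat \<Rightarrow> 'a))) set)) = q ^ (m - e)"
  proof -
    \<comment> \<open>The case \<open>i = e\<close>: here \<open>q * p ^ e = q * q\<close>, and
      \<open>n_pow p e e = 1\<close> because its products are empty.\<close>
    have "real (card {b \<in> ?C. ?ev b = of_nat (q * q)}) = real (q ^ (m - e))"
      using count[of e] by (simp add: assms(3) n_pow_def rank_quotient_def)
    then show ?thesis
      using card_components_wenger[OF \<chi>, of m] by (simp only: of_nat_eq_iff char assms(5))
  qed
  moreover have "spectrum A = {0} \<union> (\<Union>i\<in>{0..e}. {?s i, - ?s i})"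
  proof -
    have "A \<in> carrier_mat (length vs) (length vs)"
      by (simp add: assms(8) adjacency_matrix_def)
    then have spec: "z \<in> spectrum A \<longleftrightarrow> (\<exists>b\<in>?C. ?ev b = z\<^sup>2)" for z
    proof -
      have "poly (char_poly A) z = (\<Prod>b\<in>?C. z\<^sup>2 - ?ev b)"
        by (simp add: cp poly_prod power2_eq_square)
      then have "poly (char_poly A) z = 0 \<longleftrightarrow> (\<exists>b\<in>?C. z\<^sup>2 = ?ev b)"
        by simp
      then show ?thesis
        using eigenvalue_root_char_poly[OF \<open>A \<in> carrier_mat (length vs) (length vs)\<close>, of z]
        unfolding spectrum_def mem_Collect_eq by metis
    qed
    show ?thesis
    proof (intro equalityI subsetI)
      fix z assume "z \<in> spectrum A"
      then obtain b where "?ev b = z\<^sup>2"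
        using spec by blast
      then have "z\<^sup>2 = 0 \<or> (\<exists>i\<le>e. z\<^sup>2 = of_nat (q * p ^ i))"
        using character_eigenvalue_cases[OF \<chi> card, of m b] unfolding assms(3) char by simp
      then show "z \<in> {0} \<union> (\<Union>i\<in>{0..e}. {?s i, - ?s i})"
        unfolding sq[symmetric] power2_eq_iff by auto
    next
      \<comment> \<open>Every listed value occurs because its count is positive.\<close>
      have ex: "z \<in> spectrum A" if "0 < real (card {b \<in> ?C. ?ev b = z\<^sup>2})" for z
        using that unfolding spec by (auto simp: card_gt_0_iff)
      fix z assume "z \<in> {0} \<union> (\<Union>i\<in>{0..e}. {?s i, - ?s i})"
      then consider "z = 0" | i where "i \<le> e" "z\<^sup>2 = of_nat (q * p ^ i)"
        using sq by (auto simp del: of_nat_mult)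
      then show "z \<in> spectrum A"
      proof cases
        case 1
        have "0 < real (card {b \<in> ?C. ?ev b = 0\<^sup>2})"
          using count0 n_zero_pos[OF p assms(2)] q by simp
        then show ?thesis
          unfolding 1 by (rule ex)
      next
        case (2 i)
        have "0 < real (card {b \<in> ?C. ?ev b = z\<^sup>2})"
          unfolding 2(2) count[OF 2(1)] using n_pow_pos[OF p 2(1)] q by simp
        then show ?thesis
          by (rule ex)
      qed
    qed
  qed
  \<comment> \<open>Both signs have the same square, so one count of characters serves for
    both.\<close>
  moreover have "real (eigenvalue_multiplicity A (?s i)) = real (q ^ (m - e)) * n_pow p e i \<and>
      real (eigenvalue_multiplicity A (- ?s i)) = real (q ^ (m - e)) * n_pow p e i"
    if "i \<in> {0..e}" for i
    unfolding mult power2_minus sq neg_equal_0_iff_equal using nz[of i] count[of i] that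
    by (simp del: of_nat_mult of_real_eq_0_iff)
  moreover have "real (eigenvalue_multiplicity A 0) = 2 * (real (q ^ (m - e)) * n_zero p e)"
    unfolding mult using count0 by simp
  ultimately show ?thesis
    by blast
qed

end
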